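(* Let $\hat{A}\in\mathbb{DC}^{n\times n}$. Then there exist integers $0\le r\le t\le n$, a unitary matrix $\hat{U}\in\mathbb{DC}^{n\times n}$, diagonal matrices $\hat{\Sigma}_1=\mathrm{diag}(\hat{\mu}_1,\dots,\hat{\mu}_r)\in\mathbb{D}^{r\times r}$ with $\hat{\mu}_1\ge\dots\ge\hat{\mu}_r>0$ appreciable dual numbers and $\hat{\Sigma}_2=\mathrm{diag}(\hat{\mu}_{r+1},\dots,\hat{\mu}_t,0,\dots,0)\in\mathbb{D}^{(n-r)\times(n-r)}$ with $\hat{\mu}_{r+1}\ge\dots\ge\hat{\mu}_t>0$ infinitesimal dual numbers, and matrices $\hat{K}\in\mathbb{DC}^{r\times r}$, $\hat{L}\in\mathbb{DC}^{r\times(n-r)}$, $\hat{M}\in\mathbb{DC}^{(n-r)\times r}$, $\hat{N}\in\mathbb{DC}^{(n-r)\times(n-r)}$ with $\hat{K}\hat{K}^*+\hat{L}\hat{L}^*=I_r$ and $\hat{K}\hat{M}^*+\hat{L}\hat{N}^*=O$, such that $$\hat{A}=\hat{U}\begin{bmatrix}\hat{\Sigma}_1\hat{K}&\hat{\Sigma}_1\hat{L}\\ \hat{\Sigma}_2\hat{M}&\hat{\Sigma}_2\hat{N}\end{bmatrix}\hat{U}^*.$$ Furthermore, the essential part $A_e$ of $\hat{A}$ satisfies $$A_e=\hat{U}\begin{bmatrix}\hat{\Sigma}_1\hat{K}&\hat{\Sigma}_1\hat{L}\\ O&O\end{bmatrix}\hat{U}^*.$$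
   Context: $\mathbb{D}$ is the ring of dual numbers $\hat a=a_s+a_d\epsilon$ with $a_s,a_d\in\mathbb{R}$ and $\epsilon^2=0$; $\mathbb{DC}$ is the ring of dual complex numbers, defined in the same way with $a_s,a_d\in\mathbb{C}$. A dual number is appreciable if $a_s\ne0$ and infinitesimal if $a_s=0$. $\mathbb{D}$ is totally ordered by: $\hat a<\hat b$ iff $a_s<b_s$, or $a_s=b_s$ and $a_d<b_d$. Every $\hat{A}\in\mathbb{DC}^{m\times n}$ is written $\hat{A}=A_s+A_d\epsilon$ with $A_s,A_d$ complex matrices, and $\hat{A}^*=A_s^*+A_d^*\epsilon$ (conjugate transpose). $\hat{U}$ is unitary if $\hat{U}^*\hat{U}=\hat{U}\hat{U}^*=I$. SVD (known theorem): every $\hat{A}\in\mathbb{DC}^{m\times n}$ can be written $\hat{A}=\hat{U}\begin{bmatrix}\hat{\Sigma}_1&O\\O&\hat{\Sigma}_2\end{bmatrix}\hat{V}^*$ with $\hat{U}\in\mathbb{DC}^{m\times m}$, $\hat{V}\in\mathbb{DC}^{n\times n}$ unitary, $\hat{\Sigma}_1=\mathrm{diag}(\hat{\mu}_1,\dots,\hat{\mu}_r)$ with $\hat{\mu}_1\ge\dots\ge\hat{\mu}_r$ positive appreciable dual numbers, and $\hat{\Sigma}_2=\mathrm{diag}(\hat{\mu}_{r+1},\dots,\hat{\mu}_t,0,\dots,0)$ of size $(m-r)\times(n-r)$ with $\hat{\mu}_{r+1}\ge\dots\ge\hat{\mu}_t$ positive infinitesimal dual numbers. The essential part of $\hat{A}$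 is $A_e=\hat{U}\begin{bmatrix}\hat{\Sigma}_1&O\\O&O\end{bmatrix}\hat{V}^*$ (it does not depend on the chosen SVD). *)

theory Defs
  imports "Jordan_Normal_Form.Matrix" "Jordan_Normal_Form.Conjugate"
begin

section \<open>Dual numbers\<close>

text \<open>\<open>Dual a b\<close> stands for \<open>a + b \<epsilon>\<close> with \<open>\<epsilon>\<^sup>2 = 0\<close>.\<close>

datatype 'a dual_number = Dual (std_part: 'a) (dual_part: 'a)

lemma dual_number_eq_iff:
  "a = b \<longleftrightarrow> std_part a = std_part b \<and> dual_part a = dual_part b"
  by (auto intro: dual_number.expand)

type_synonym real_dual = "real dual_number"
type_synonym complex_dual = "complex dual_number"

instantiation dual_number :: (comm_ring_1) comm_ring_1
begin

definition "0 = Dual 0 0"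
definition "1 = Dual 1 0"
definition "a + b = Dual (std_part a + std_part b) (dual_part a + dual_part b)"
definition "- a = Dual (- std_part a) (- dual_part a)"
definition "a - b = Dual (std_part a - std_part b) (dual_part a - dual_part b)"
definition "a * b = Dual (std_part a * std_part b)
   (std_part a * dual_part b + dual_part a * std_part b)"

instance
  by standard
    (auto simp: zero_dual_number_def one_dual_number_def plus_dual_number_def
      uminus_dual_number_def minus_dual_number_def times_dual_number_def algebra_simps)

end

text \<open>The total order is lexicographic, standard part first.\<close>

instantiation dual_number :: (linorder) linorder
begin

definition "a < b \<longleftrightarrow>
  std_part a < std_part b \<or> std_part a = std_part b \<and> dual_part a < dual_part b"
definition "a \<le> b \<longleftrightarrow> a < b \<or> a = (b :: 'a dual_number)"

instance
  by standard
    (auto simp: less_dual_number_def less_eq_dual_number_def dual_number_eq_iff)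

end

text \<open>Conjugation acts on both parts: the conjugate of \<open>a + b \<epsilon>\<close> is
  \<open>cnj a + cnj b \<epsilon>\<close>. Consequently \<open>ctranspose\<close> below sends \<open>A\<^sub>s + A\<^sub>d \<epsilon>\<close> to
  \<open>A\<^sub>s\<^sup>* + A\<^sub>d\<^sup>* \<epsilon>\<close>.\<close>

instantiation dual_number :: ("{comm_ring_1, conjugatable_ring}") conjugatable_ring
begin

definition "conjugate a = Dual (conjugate (std_part a)) (conjugate (dual_part a))"

instance
  by standard
    (auto simp: conjugate_dual_number_def zero_dual_number_def plus_dual_number_def
      uminus_dual_number_def times_dual_number_def conjugate_dist_mul conjugate_dist_add
      conjugate_neg dual_number_eq_iff)

end

definition appreciable :: "'a::zero dual_number \<Rightarrow> bool" where
  "appreciable a \<longleftrightarrow> std_part a \<noteq> 0"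

definition infinitesimal :: "'a::zero dual_number \<Rightarrow> bool" where
  "infinitesimal a \<longleftrightarrow> std_part a = 0"

definition complex_of_dual :: "real_dual \<Rightarrow> complex_dual" where
  "complex_of_dual a = Dual (complex_of_real (std_part a)) (complex_of_real (dual_part a))"

abbreviation complex_mat_of_dual :: "real_dual mat \<Rightarrow> complex_dual mat" where
  "complex_mat_of_dual \<equiv> map_mat complex_of_dual"


section \<open>Dual complex matrices\<close>

text \<open>The library's \<open>mat_adjoint\<close> is restricted to fields, so it does not apply to dual numbers.\<close>

definition ctranspose :: "complex_dual mat \<Rightarrow> complex_dual mat" where
  "ctranspose A = transpose_mat (map_mat conjugate A)"

definition unitary_mat :: "nat \<Rightarrow> complex_dual mat \<Rightarrow> bool" where
  "unitary_mat n U \<longleftrightarrow>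
     U \<in> carrier_mat n n \<and> ctranspose U * U = 1\<^sub>m n \<and> U * ctranspose U = 1\<^sub>m n"

definition rect_diag_mat :: "nat \<Rightarrow> nat \<Rightarrow> (nat \<Rightarrow> 'a::zero) \<Rightarrow> 'a mat" where
  "rect_diag_mat m n d = mat m n (\<lambda>(i, j). if i = j then d i else 0)"


section \<open>Singular values and the essential part\<close>

text \<open>Indices start at \<open>0\<close>: the entries \<open>\<mu> 0, \<dots>, \<mu> (r - 1)\<close> are the appreciable
  singular values and \<open>\<mu> r, \<dots>, \<mu> (t - 1)\<close> the nonzero infinitesimal ones.
  Values of \<open>\<mu>\<close> from index \<open>t\<close> on are irrelevant.\<close>

definition singular_values :: "nat \<Rightarrow> nat \<Rightarrow> (nat \<Rightarrow> real_dual) \<Rightarrow> bool" where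
  "singular_values r t \<mu> \<longleftrightarrow>
     (\<forall>i<r. 0 < \<mu> i \<and> appreciable (\<mu> i)) \<and>
     (\<forall>i j. i \<le> j \<and> j < r \<longrightarrow> \<mu> j \<le> \<mu> i) \<and>
     (\<forall>i. r \<le> i \<and> i < t \<longrightarrow> 0 < \<mu> i \<and> infinitesimal (\<mu> i)) \<and>
     (\<forall>i j. r \<le> i \<and> i \<le> j \<and> j < t \<longrightarrow> \<mu> j \<le> \<mu> i)"

definition Sigma1_mat :: "nat \<Rightarrow> (nat \<Rightarrow> real_dual) \<Rightarrow> real_dual mat" where
  "Sigma1_mat r \<mu> = mat_diag r \<mu>"

definition Sigma2_mat :: "nat \<Rightarrow> nat \<Rightarrow> nat \<Rightarrow> nat \<Rightarrow> (nat \<Rightarrow> real_dual) \<Rightarrow> real_dual mat" where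
  "Sigma2_mat m n r t \<mu> =
     rect_diag_mat (m - r) (n - r) (\<lambda>i. if r + i < t then \<mu> (r + i) else 0)"

definition is_svd :: "complex_dual mat \<Rightarrow> nat \<Rightarrow> nat \<Rightarrow> (nat \<Rightarrow> real_dual) \<Rightarrow>
    complex_dual mat \<Rightarrow> complex_dual mat \<Rightarrow> bool" where
  "is_svd A r t \<mu> U V \<longleftrightarrow>
     (let m = dim_row A; n = dim_col A in
        r \<le> t \<and> t \<le> min m n \<and> singular_values r t \<mu> \<and>
        unitary_mat m U \<and> unitary_mat n V \<and>
        A = U * four_block_mat
                  (complex_mat_of_dual (Sigma1_mat r \<mu>)) (0\<^sub>m r (n - r))
                  (0\<^sub>m (m - r) r) (complex_mat_of_dual (Sigma2_mat m n r t \<mu>))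
              * ctranspose V)"

text \<open>The definite description is meaningful because every matrix has an SVD and the truncated
  product is the same for all of them.\<close>

definition essential_part :: "complex_dual mat \<Rightarrow> complex_dual mat" where
  "essential_part A = (THE E. \<exists>r t \<mu> U V. is_svd A r t \<mu> U V \<and>
     E = U * four_block_mat
               (complex_mat_of_dual (Sigma1_mat r \<mu>)) (0\<^sub>m r (dim_col A - r))
               (0\<^sub>m (dim_row A - r) r) (0\<^sub>m (dim_row A - r) (dim_col A - r))
           * ctranspose V)"

end

theory Submission
  imports Defs "Jordan_Normal_Form.Spectral_Radius"
begin

text \<open>By a singular value decomposition of the standard part and a unitary transformation infinitely
  close to the identity, every dual matrix is brought to a form whose infinitesimal part couples only
  equal singular values and is Hermitian where these are nonzero. On the nonzero part both components
  are then commuting Hermitian matrices \<open>P\<close>, \<open>Q\<close>, diagonalized together because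
  \<open>P + \<i>Q\<close> is normal; on the zero part an ordinary singular value decomposition of the
  infinitesimal component remains. This gives \<open>A = U \<Sigma> V\<^sup>*\<close>, and with the unitary
  \<open>W = V\<^sup>* U\<close>, cut into the blocks \<open>K, L, M, N\<close>, it reads \<open>A = U (\<Sigma> W) U\<^sup>*\<close>.\<close>

section \<open>Unitary equivalence\<close>

text \<open>The obstacle is degeneracy. A first-order change of the unitary factors removes only the
  skew-Hermitian half of the coupling between equal nonzero singular values, and nothing at all
  where the singular value is zero. The Hermitian half that stays is harmless: the standard part is
  scalar on each group of equal values, so the two components commute. On the zero block the
  standard part survives any pair of unitaries, so there the left and the right factor can be chosen
  independently. The claim on the essential part concerns a definite description, so the truncated
  products of all decompositions must agree, not only the one constructed here. Over the dual
  numbers \<open>adj X * X = 0\<close> does not force \<open>X = 0\<close> (take \<epsilon>), hence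
  this comparison is carried out on the infinitesimal components, which are complex matrices. The
  two identities for \<open>K\<close>, \<open>L\<close>, \<open>M\<close>, \<open>N\<close> are the
  upper blocks of \<open>W * adj W = 1\<close>.\<close>

lemma conjugate_one [simp]: "conjugate (1 :: 'a :: {comm_ring_1, conjugatable_ring}) = 1"
  by (metis conjugate_dist_mul conjugate_id mult.right_neutral mult.left_neutral)

text \<open>Polymorphic in the entries because the argument alternates between complex and dual
  complex matrices; \<open>ctranspose\<close> is fixed to the latter.\<close>

definition adj :: "'a :: conjugatable_ring mat \<Rightarrow> 'a mat" where
  "adj A = transpose_mat (map_mat conjugate A)"

definition is_unitary :: "nat \<Rightarrow> 'a :: {comm_ring_1, conjugatable_ring} mat \<Rightarrow> bool" where
  "is_unitary n U \<longleftrightarrow> U \<in> carrier_mat n n \<and> adj U * U = 1\<^sub>m n \<and> U * adj U = 1\<^sub>m n"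

text \<open>The two unitaries are independent, as in a singular value decomposition; with
  \<open>U = V\<close> this would be unitary similarity.\<close>

definition unit_equiv :: "nat \<Rightarrow> 'a :: {comm_ring_1, conjugatable_ring} mat \<Rightarrow> 'a mat \<Rightarrow> bool" where
  "unit_equiv n A B \<longleftrightarrow>
     B \<in> carrier_mat n n \<and> (\<exists>U V. is_unitary n U \<and> is_unitary n V \<and> A = U * B * adj V)"

lemma ctranspose_eq_adj: "ctranspose = adj"
  by (simp add: fun_eq_iff ctranspose_def adj_def)

lemma unitary_mat_eq_is_unitary: "unitary_mat = is_unitary"
  by (simp add: fun_eq_iff unitary_mat_def is_unitary_def ctranspose_eq_adj)

lemma dim_adj [simp]: "dim_row (adj A) = dim_col A" "dim_col (adj A) = dim_row A"
  by (simp_all add: adj_def)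

lemma adj_carrier [simp]: "A \<in> carrier_mat m n \<Longrightarrow> adj A \<in> carrier_mat n m"
  by (simp add: adj_def)

lemma index_adj [simp]:
  "i < dim_col A \<Longrightarrow> j < dim_row A \<Longrightarrow> adj A $$ (i, j) = conjugate (A $$ (j, i))"
  by (simp add: adj_def)

lemma index_mult_sum:
  "i < dim_row A \<Longrightarrow> j < dim_col B \<Longrightarrow>
    (A * B) $$ (i, j) = (\<Sum>k<dim_row B. A $$ (i, k) * B $$ (k, j))"
  if "dim_col A = dim_row B"
  using that by (auto simp: scalar_prod_def atLeast0LessThan intro!: sum.cong)

lemma adj_adj [simp]: "adj (adj A) = A"
  by (rule eq_matI) simp_all

lemma adj_mult:
  fixes A B :: "'a :: {comm_ring_1, conjugatable_ring} mat"
  assumes "dim_col A = dim_row B"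
  shows "adj (A * B) = adj B * adj A"
  using assms
  by (intro eq_matI)
    (simp_all add: index_mult_sum sum_conjugate conjugate_dist_mul mult.commute
      del: index_mult_mat(1))

text \<open>Equations between dimensions, instead of carrier sets with free sizes, let the
  simplifier use associativity as a rewrite rule.\<close>

lemma assoc_mult_mat_dim:
  fixes A B C :: "'a :: semiring_0 mat"
  assumes "dim_col A = dim_row B" "dim_col B = dim_row C"
  shows "A * B * C = A * (B * C)"
  using assms by (intro assoc_mult_mat[of A "dim_row A" "dim_row B" B "dim_row C" C "dim_col C"]) auto

lemma adj_add:
  "A \<in> carrier_mat m n \<Longrightarrow> B \<in> carrier_mat m n \<Longrightarrow> adj (A + B) = adj A + adj B"
  by (intro eq_matI) (auto simp: conjugate_dist_add)

lemma adj_one [simp]: "adj (1\<^sub>m n :: 'a :: {comm_ring_1, conjugatable_ring} mat) = 1\<^sub>m n"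
  by (intro eq_matI) auto

lemma adj_zero [simp]: "adj (0\<^sub>m m n) = 0\<^sub>m n m"
  by (intro eq_matI) auto

lemma adj_smult:
  fixes A :: "'a :: {comm_ring_1, conjugatable_ring} mat"
  shows "adj (c \<cdot>\<^sub>m A) = conjugate c \<cdot>\<^sub>m adj A"
  by (intro eq_matI) (auto simp: conjugate_dist_mul)

lemma adj_mat_diag: "adj (mat_diag n f) = mat_diag n (\<lambda>i. conjugate (f i))"
  by (intro eq_matI) (auto simp: mat_diag_def)

lemma adj_four_block:
  assumes "A \<in> carrier_mat m1 n1" "B \<in> carrier_mat m1 n2"
    and "C \<in> carrier_mat m2 n1" "D \<in> carrier_mat m2 n2"
  shows "adj (four_block_mat A B C D) = four_block_mat (adj A) (adj C) (adj B) (adj D)"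
  using assms by (intro eq_matI) auto

lemma is_unitaryD:
  assumes "is_unitary n U"
  shows "U \<in> carrier_mat n n" "adj U * U = 1\<^sub>m n" "U * adj U = 1\<^sub>m n"
    "dim_row U = n" "dim_col U = n"
  using assms by (auto simp: is_unitary_def)

lemma is_unitary_adj: "is_unitary n U \<Longrightarrow> is_unitary n (adj U)"
  by (auto simp: is_unitary_def)

lemma is_unitary_one: "is_unitary n (1\<^sub>m n)"
  by (auto simp: is_unitary_def)

text \<open>The trailing factor \<open>X\<close> fits products nested to the right by
  \<open>assoc_mult_mat_dim\<close>: a unitary next to its adjoint inside a longer product then has
  this shape.\<close>

lemma unitary_cancel:
  assumes "is_unitary n U" "dim_row X = n"
  shows "U * (adj U * X) = X" "adj U * (U * X) = X"
  using is_unitaryD[OF assms(1)] assms(2)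
  by (simp_all flip: assoc_mult_mat_dim)

lemma is_unitary_mult:
  assumes U: "is_unitary n U" and V: "is_unitary n V"
  shows "is_unitary n (U * V)"
  unfolding is_unitary_def
  using is_unitaryD[OF U] is_unitaryD[OF V]
  by (auto simp: adj_mult assoc_mult_mat_dim unitary_cancel[OF U] unitary_cancel[OF V])

lemma is_unitary_four_block:
  assumes U: "is_unitary m U" and V: "is_unitary n V"
  shows "is_unitary (m + n) (four_block_mat U (0\<^sub>m m n) (0\<^sub>m n m) V)"
  using is_unitaryD[OF U] is_unitaryD[OF V]
  by (simp add: is_unitary_def adj_four_block[of _ m m _ n _ n]
      mult_four_block_mat[of _ m m _ n _ n _ _ m _ n])

lemma unit_equivI:
  assumes U: "is_unitary n U" and V: "is_unitary n V" and A: "A \<in> carrier_mat n n"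
    and B: "adj U * A * V = B"
  shows "unit_equiv n A B"
proof -
  note c = is_unitaryD[OF U] is_unitaryD[OF V]
  have "A = U * B * adj V"
    unfolding B[symmetric] using c carrier_matD[OF A]
    by (simp add: assoc_mult_mat_dim unitary_cancel[OF U])
  moreover have "B \<in> carrier_mat n n" unfolding B[symmetric] using c A by auto
  ultimately show ?thesis using U V by (auto simp: unit_equiv_def)
qed

lemma unit_equivE:
  assumes "unit_equiv n A B"
  obtains U V where "is_unitary n U" "is_unitary n V" "adj U * A * V = B" "A = U * B * adj V"
proof -
  obtain U V where U: "is_unitary n U" and V: "is_unitary n V" and A: "A = U * B * adj V"
    and B: "B \<in> carrier_mat n n"
    using assms by (auto simp: unit_equiv_def)
  have "adj U * A * V = B"
    unfolding A using is_unitaryD[OF U] is_unitaryD[OF V] carrier_matD[OF B] B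
    by (simp add: assoc_mult_mat_dim unitary_cancel[OF U])
  with U V A show thesis using that by blast
qed

lemma unit_equiv_trans:
  assumes "unit_equiv n A B" "unit_equiv n B C"
  shows "unit_equiv n A C"
proof -
  obtain U V where U: "is_unitary n U" and V: "is_unitary n V" and A: "A = U * B * adj V"
    using assms(1) by (auto simp: unit_equiv_def)
  obtain U' V' where U': "is_unitary n U'" and V': "is_unitary n V'" and B: "B = U' * C * adj V'"
    and C: "C \<in> carrier_mat n n"
    using assms(2) by (auto simp: unit_equiv_def)
  note c = is_unitaryD[OF U] is_unitaryD[OF V] is_unitaryD[OF U'] is_unitaryD[OF V']
  have "A = (U * U') * C * adj (V * V')"
    unfolding A B using c carrier_matD[OF C] by (simp add: adj_mult assoc_mult_mat_dim)
  then show ?thesis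
    using is_unitary_mult[OF U U'] is_unitary_mult[OF V V'] C by (auto simp: unit_equiv_def)
qed

lemma unit_equiv_refl: "A \<in> carrier_mat n n \<Longrightarrow> unit_equiv n A A"
  by (rule unit_equivI[OF is_unitary_one is_unitary_one]) auto

section \<open>Reordering diagonal entries\<close>

lemma unit_equiv_permute:
  fixes f :: "nat \<Rightarrow> 'a :: {comm_ring_1, conjugatable_ring}"
  assumes p: "bij_betw p {..<n} {..<n}"
  shows "unit_equiv n (mat_diag n f) (mat_diag n (f \<circ> p))"
proof -
  \<comment> \<open>Column \<open>j\<close> of \<open>P\<close> is the basis vector with index
    \<open>p j\<close>, so \<open>P\<close> carries position \<open>j\<close> to position
    \<open>p j\<close>.\<close>
  define P :: "'a mat" where "P = mat n n (\<lambda>(i, j). if i = p j then 1 else 0)"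
  have inj: "i < n \<Longrightarrow> j < n \<Longrightarrow> p i = p j \<longleftrightarrow> i = j" for i j
    using bij_betw_imp_inj_on[OF p] by (auto dest: inj_onD)
  have lt: "i < n \<Longrightarrow> p i < n" for i using bij_betwE[OF p] by auto
  have P: "P \<in> carrier_mat n n" by (simp add: P_def)
  have 1: "adj P * P = 1\<^sub>m n"
    using lt inj by (intro eq_matI)
      (auto simp: P_def index_mult_sum if_distrib[of conjugate] if_distrib[of "\<lambda>x. x * _"]
       sum.If_cases simp del: index_mult_mat(1) cong: if_cong)
  have 2: "P * adj P = 1\<^sub>m n"
  proof (intro eq_matI)
    fix i j assume "i < dim_row (1\<^sub>m n :: 'a mat)" "j < dim_col (1\<^sub>m n :: 'a mat)"
    then have ij: "i < n" "j < n" by auto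
    have "(P * adj P) $$ (i, j)
        = (\<Sum>k<n. (if i = p k then 1 else 0) * (if j = p k then 1 else 0))"
      using ij by (auto simp: P_def index_mult_sum simp del: index_mult_mat(1) intro!: sum.cong)
    \<comment> \<open>Orthonormality of the columns used only that \<open>p\<close> is injective;
      for the rows the sum is reindexed along the whole bijection.\<close>
    also have "\<dots> = (\<Sum>k<n. (if i = k then 1 else 0) * (if j = k then 1 else 0))"
      using sum.reindex_bij_betw[OF p,
          of "\<lambda>k. (if i = k then 1 else 0) * (if j = k then 1 else (0 :: 'a))"] by simp
    also have "\<dots> = (1\<^sub>m n :: 'a mat) $$ (i, j)"
      using ij by (simp add: if_distrib[of "\<lambda>x. x * _"] cong: if_cong)
    finally show "(P * adj P) $$ (i, j) = (1\<^sub>m n :: 'a mat) $$ (i, j)" .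
  qed (auto simp: P_def)
  have U: "is_unitary n P" using P 1 2 by (simp add: is_unitary_def)
  have "mat_diag n f * P = P * mat_diag n (f \<circ> p)"
    unfolding mat_diag_mult_left[OF P] mat_diag_mult_right[OF P]
    by (intro eq_matI) (auto simp: P_def)
  then have "adj P * mat_diag n f * P = mat_diag n (f \<circ> p)"
    using carrier_matD[OF P] by (simp add: assoc_mult_mat_dim unitary_cancel[OF U] mat_diag_def)
  then show ?thesis by (intro unit_equivI[OF U U]) auto
qed

lemma obtain_descending_permutation:
  fixes f :: "nat \<Rightarrow> 'a :: linorder"
  obtains p where "bij_betw p {..<n} {..<n}" "\<And>i j. i \<le> j \<Longrightarrow> j < n \<Longrightarrow> f (p j) \<le> f (p i)"
proof -
  define xs where "xs = rev (sort_key f [0..<n])"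
  have xs: "distinct xs" "length xs = n" "set xs = {..<n}" by (auto simp: xs_def)
  have "bij_betw ((!) xs) {..<n} {..<n}" using bij_betw_nth[OF xs(1)] xs by auto
  moreover have "f (xs ! j) \<le> f (xs ! i)" if "i \<le> j" "j < n" for i j
  proof -
    have "sorted (map f (rev xs))" by (simp add: xs_def)
    then have "map f (rev xs) ! (n - Suc j) \<le> map f (rev xs) ! (n - Suc i)"
      using that xs by (intro sorted_nth_mono) auto
    then show ?thesis using that xs by (simp add: rev_nth)
  qed
  ultimately show thesis by (rule that)
qed

text \<open>Applied to descending sequences, this yields the ranks at which a standard part or a
  whole value becomes zero.\<close>

lemma obtain_threshold:
  fixes P :: "nat \<Rightarrow> bool"
  assumes "\<And>i j. i \<le> j \<Longrightarrow> j < n \<Longrightarrow> P j \<Longrightarrow> P i"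
  obtains r where "r \<le> n" "\<And>i. i < n \<Longrightarrow> P i \<longleftrightarrow> i < r"
proof
  \<comment> \<open>The disjunct \<open>i = n\<close> provides a witness for the least element when
    \<open>P\<close> holds at every index below \<open>n\<close>.\<close>
  define r where "r = (LEAST i. i = n \<or> \<not> P i)"
  show "r \<le> n" unfolding r_def by (rule Least_le) simp
  have "r = n \<or> \<not> P r" unfolding r_def by (rule LeastI[of _ n]) simp
  then show "P i \<longleftrightarrow> i < r" if "i < n" for i
    using assms[of r i] that not_less_Least[of i "\<lambda>i. i = n \<or> \<not> P i"]
    by (metis r_def leI nat_neq_iff)
qed

section \<open>Complex matrices\<close>

lemma adj_mult_self_index:
  fixes A :: "complex mat"
  assumes "j < dim_col A"
  shows "(adj A * A) $$ (j, j) = complex_of_real (\<Sum>k<dim_row A. (cmod (A $$ (k, j)))\<^sup>2)"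
proof -
  have "(adj A * A) $$ (j, j) = (\<Sum>k<dim_row A. A $$ (k, j) * cnj (A $$ (k, j)))"
    using assms by (simp add: index_mult_sum mult.commute del: index_mult_mat(1))
  then show ?thesis by (simp only: complex_norm_square[symmetric] of_real_sum of_real_power)
qed

text \<open>The diagonal entries of \<open>adj A * A\<close> are the squared norms of the columns of
  \<open>A\<close>.\<close>

lemma adj_mult_self_eq_0:
  fixes A :: "complex mat"
  assumes "adj A * A = 0\<^sub>m (dim_col A) (dim_col A)"
  shows "A = 0\<^sub>m (dim_row A) (dim_col A)"
proof (intro eq_matI)
  fix i j assume "i < dim_row (0\<^sub>m (dim_row A) (dim_col A) :: complex mat)"
    and "j < dim_col (0\<^sub>m (dim_row A) (dim_col A) :: complex mat)"
  then have i: "i < dim_row A" and j: "j < dim_col A" by auto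
  have "complex_of_real (\<Sum>k<dim_row A. (cmod (A $$ (k, j)))\<^sup>2) = 0"
    unfolding adj_mult_self_index[OF j, symmetric] assms using j by simp
  then have "(\<Sum>k<dim_row A. (cmod (A $$ (k, j)))\<^sup>2) = 0"
    by (simp only: of_real_eq_0_iff)
  then have "(cmod (A $$ (i, j)))\<^sup>2 = 0"
    using i by (subst (asm) sum_nonneg_eq_0_iff) auto
  then show "A $$ (i, j) = 0\<^sub>m (dim_row A) (dim_col A) $$ (i, j)" using i j by simp
qed auto

section \<open>Unit eigenvectors and deflation\<close>

lemma obtain_unit_eigenvector:
  fixes A :: "complex mat"
  assumes A: "A \<in> carrier_mat n n" and n: "n > 0"
  obtains x l where "x \<in> carrier_mat n 1" "adj x * x = 1\<^sub>m 1" "A * x = l \<cdot>\<^sub>m x"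
proof -
  obtain l where "eigenvalue A l" using spectrum_non_empty[OF A n] by (auto simp: spectrum_def)
  then obtain v where v: "v \<in> carrier_vec n" "v \<noteq> 0\<^sub>v n" "A *\<^sub>v v = l \<cdot>\<^sub>v v"
    using A by (auto simp: eigenvalue_def eigenvector_def)
  \<comment> \<open>From here on vectors are matrices with one column, so that \<open>adj\<close>,
    products and associativity apply to them unchanged.\<close>
  define y where "y = mat n 1 (\<lambda>(i, _). v $ i)"
  have y: "y \<in> carrier_mat n 1" by (simp add: y_def)
  have Ay: "A * y = l \<cdot>\<^sub>m y"
  proof (intro eq_matI)
    fix i j assume "i < dim_row (l \<cdot>\<^sub>m y)" "j < dim_col (l \<cdot>\<^sub>m y)"
    then have i: "i < n" and j: "j = 0" by (auto simp: y_def)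
    have "(A * y) $$ (i, j) = (A *\<^sub>v v) $ i"
      using A i j v(1) by (auto simp: y_def scalar_prod_def intro!: sum.cong)
    then show "(A * y) $$ (i, j) = (l \<cdot>\<^sub>m y) $$ (i, j)" using i j v by (simp add: y_def)
  qed (use A in \<open>auto simp: y_def\<close>)
  define s where "s = (\<Sum>k<n. (cmod (y $$ (k, 0)))\<^sup>2)"
  have yy: "adj y * y = complex_of_real s \<cdot>\<^sub>m 1\<^sub>m 1"
    using y adj_mult_self_index[of 0 y] by (intro eq_matI) (auto simp: s_def simp del: index_mult_mat(1))
  have "s \<noteq> 0"
  proof
    assume "s = 0"
    then have "adj y * y = 0\<^sub>m 1 1" unfolding yy by (intro eq_matI) auto
    then have "y = 0\<^sub>m n 1" using adj_mult_self_eq_0[of y] y by auto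
    then have "v = 0\<^sub>v n" using v(1) by (auto simp: y_def mat_eq_iff)
    then show False using v by simp
  qed
  moreover have "s \<ge> 0" by (auto simp: s_def intro: sum_nonneg)
  ultimately have s: "s > 0" by simp
  define x where "x = complex_of_real (1 / sqrt s) \<cdot>\<^sub>m y"
  have "adj x * x = (complex_of_real (1 / sqrt s) * complex_of_real (1 / sqrt s)) \<cdot>\<^sub>m (adj y * y)"
    unfolding x_def adj_smult using y
    by (auto simp: mult_smult_assoc_mat[of _ 1 n _ 1] mult_smult_distrib[of _ 1 n _ 1])
  also have "\<dots> = 1\<^sub>m 1"
    unfolding yy using s by (intro eq_matI) (auto simp flip: of_real_mult)
  finally have "adj x * x = 1\<^sub>m 1" .
  moreover have "A * x = l \<cdot>\<^sub>m x"
    unfolding x_def using A y by (auto simp: mult_smult_distrib[of _ n n _ 1] Ay mult.commute)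
  moreover have "x \<in> carrier_mat n 1" using y by (simp add: x_def)
  ultimately show thesis by (rule that[rotated])
qed

text \<open>A Householder reflection times a phase. With the phase \<open>a\<close> of the first entry of \<open>x\<close>,
  reflecting along \<open>e\<^sub>0 + cnj a \<cdot> x\<close> rather than \<open>e\<^sub>0 - cnj a \<cdot> x\<close> avoids the degenerate case
  \<open>x = a \<cdot> e\<^sub>0\<close>.\<close>

lemma obtain_unitary_first_column:
  fixes x :: "complex mat"
  assumes x: "x \<in> carrier_mat (Suc n) 1" and unit: "adj x * x = 1\<^sub>m 1"
  obtains W where "is_unitary (Suc n) W"
    "W * mat (Suc n) 1 (\<lambda>(i, _). if i = 0 then 1 else 0) = x"
proof -
  define X where "X i = x $$ (i, 0)" for i
  \<comment> \<open>\<open>sgn\<close> would give 0 for a vanishing entry, but \<open>a\<close> must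
    have modulus 1; any phase would do in that case.\<close>
  define a where "a = (if X 0 = 0 then 1 else sgn (X 0))"
  have aa: "a * cnj a = 1" by (simp add: a_def complex_norm_square[symmetric] norm_sgn)
  have aX: "cnj a * X 0 = of_real (cmod (X 0))"
    by (auto simp: a_def sgn_div_norm complex_norm_square[symmetric] power2_eq_square scaleR_conv_of_real
        mult.commute[of "cnj _"] field_simps)
  \<comment> \<open>The squared norm of \<open>w\<close> turns out to be \<open>2 * c\<close>, so
    \<open>h\<close> below is the reflection along \<open>w\<close>; moreover \<open>c\<close> is at
    least 1, which makes the division safe.\<close>
  define c where "c = 1 + cmod (X 0)"
  have c: "c > 0" by (simp add: c_def add_pos_nonneg)
  define w where "w i = (if i = 0 then 1 else 0) + cnj a * X i" for i
  have "(adj x * x) $$ (0, 0) = (\<Sum>k<Suc n. X k * cnj (X k))"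
    using x by (simp add: index_mult_sum X_def mult.commute del: index_mult_mat(1) sum.lessThan_Suc)
  then have XX: "(\<Sum>k<Suc n. X k * cnj (X k)) = 1" unfolding unit by simp
  have "(\<Sum>k<Suc n. w k * cnj (w k)) = (\<Sum>k<Suc n. (if k = 0 then 1 + cnj a * X 0 + a * cnj (X 0) else 0)
      + (a * cnj a) * (X k * cnj (X k)))"
    by (intro sum.cong) (auto simp: w_def algebra_simps)
  also have "\<dots> = 2 + cnj a * X 0 + cnj (cnj a * X 0)"
    unfolding sum.distrib sum_distrib_left[symmetric] XX aa by (simp add: sum.If_cases)
  also have "\<dots> = 2 * complex_of_real c" unfolding aX by (simp add: c_def)
  finally have ww: "(\<Sum>k<Suc n. w k * cnj (w k)) = 2 * complex_of_real c" .
  define \<delta> :: "nat \<Rightarrow> nat \<Rightarrow> complex" where "\<delta> i j = (if i = j then 1 else 0)" for i j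
  define h where "h i j = \<delta> i j - w i * cnj (w j) / of_real c" for i j
  \<comment> \<open>Since \<open>w 0 = c\<close>, the reflection sends the first basis vector to
    \<open>- cnj a\<close> times \<open>x\<close>; the factor \<open>- a\<close> corrects this to
    \<open>x\<close>.\<close>
  define W where "W = mat (Suc n) (Suc n) (\<lambda>(i, j). - a * h i j)"
  have W: "W \<in> carrier_mat (Suc n) (Suc n)" by (simp add: W_def)
  have hh: "(\<Sum>k<Suc n. h i k * cnj (h j k)) = \<delta> i j" if ij: "i < Suc n" "j < Suc n" for i j
  proof -
    have "(\<Sum>k<Suc n. h i k * cnj (h j k)) =
      (\<Sum>k<Suc n. \<delta> i k * \<delta> j k - \<delta> i k * (cnj (w j) * w k / c) - \<delta> j k * (w i * cnj (w k) / c)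
         + (w i * cnj (w j) / (c * c)) * (w k * cnj (w k)))"
      by (intro sum.cong) (auto simp: h_def \<delta>_def algebra_simps)
    also have "\<dots> = \<delta> i j - cnj (w j) * w i / c - w i * cnj (w j) / c
         + (w i * cnj (w j) / (c * c)) * (2 * complex_of_real c)"
      unfolding sum.distrib sum_subtractf sum_distrib_left[symmetric] ww
      using ij unfolding \<delta>_def if_distrib[of "\<lambda>x. x * _"] by (simp cong: if_cong del: sum.lessThan_Suc)
    also have "\<dots> = \<delta> i j" using c by (simp add: field_simps)
    finally show ?thesis .
  qed
  have 1: "W * adj W = 1\<^sub>m (Suc n)"
  proof (intro eq_matI)
    fix i j assume "i < dim_row (1\<^sub>m (Suc n) :: complex mat)" "j < dim_col (1\<^sub>m (Suc n) :: complex mat)"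
    then have ij: "i < Suc n" "j < Suc n" by auto
    have "(W * adj W) $$ (i, j) = (\<Sum>k<Suc n. (a * cnj a) * (h i k * cnj (h j k)))"
      using ij by (auto simp: W_def index_mult_sum simp del: index_mult_mat(1) sum.lessThan_Suc intro!: sum.cong)
    also have "\<dots> = \<delta> i j" unfolding sum_distrib_left[symmetric] hh[OF ij] aa by simp
    finally show "(W * adj W) $$ (i, j) = 1\<^sub>m (Suc n) $$ (i, j)" using ij by (simp add: \<delta>_def)
  qed (auto simp: W_def)
  have "is_unitary (Suc n) W"
    using mat_mult_left_right_inverse[OF W adj_carrier[OF W] 1] 1 W by (simp add: is_unitary_def)
  moreover have "W * mat (Suc n) 1 (\<lambda>(i, _). if i = 0 then 1 else 0) = x"
  proof (intro eq_matI)
    fix i j assume "i < dim_row x" "j < dim_col x"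
    then have ij: "i < Suc n" "j = 0" using x by auto
    have w0: "cnj (w 0) = of_real c" using arg_cong[OF aX, of cnj] by (simp add: w_def c_def)
    have "(W * mat (Suc n) 1 (\<lambda>(i, _). if i = 0 then 1 else 0)) $$ (i, j)
      = (\<Sum>k<Suc n. if k = 0 then - a * h i k else 0)"
      using ij by (simp add: W_def index_mult_sum if_distrib[of "\<lambda>x. _ * x"] if_distrib[of uminus]
          del: index_mult_mat(1) sum.lessThan_Suc cong: if_cong)
    also have "\<dots> = - a * h i 0" by (simp add: sum.If_cases)
    also have "\<dots> = (a * cnj a) * X i" using c by (simp add: h_def w0 \<delta>_def) (simp add: w_def algebra_simps)
    finally show "(W * mat (Suc n) 1 (\<lambda>(i, _). if i = 0 then 1 else 0)) $$ (i, j) = x $$ (i, j)"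
      using ij by (simp add: aa X_def)
  qed (use x in \<open>auto simp: W_def\<close>)
  ultimately show thesis by (rule that)
qed

text \<open>In the new bases \<open>col\<close> determines the first column and \<open>row\<close>,
  read through the adjoint, the first row. With \<open>s\<close> complex and \<open>U\<close>,
  \<open>V\<close> separate, the lemma serves both singular pairs and, for \<open>U = V\<close>,
  eigenvectors of normal matrices.\<close>

lemma obtain_deflation:
  fixes A :: "complex mat" and n :: nat
  defines "e \<equiv> mat (Suc n) 1 (\<lambda>(i, _). if i = 0 then 1 else (0 :: complex))"
  assumes A: "A \<in> carrier_mat (Suc n) (Suc n)"
    and U: "is_unitary (Suc n) U" and V: "is_unitary (Suc n) V"
    and col: "A * (V * e) = s \<cdot>\<^sub>m (U * e)" and row: "adj A * (U * e) = cnj s \<cdot>\<^sub>m (V * e)"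
  obtains B where "B \<in> carrier_mat n n"
    "adj U * A * V = four_block_mat (mat 1 1 (\<lambda>_. s)) (0\<^sub>m 1 n) (0\<^sub>m n 1) B"
proof -
  define C where "C = adj U * A * V"
  note d = is_unitaryD[OF U] is_unitaryD[OF V] carrier_matD[OF A]
  have C: "C \<in> carrier_mat (Suc n) (Suc n)" using d by (auto simp: C_def)
  have e: "e \<in> carrier_mat (Suc n) 1" by (simp add: e_def)
  have ix: "(X * e) $$ (i, 0) = X $$ (i, 0)" if "X \<in> carrier_mat (Suc n) (Suc n)" "i < Suc n" for X i
  proof -
    have "(X * e) $$ (i, 0) = (\<Sum>k<Suc n. if k = 0 then X $$ (i, k) else 0)"
      using that
      by (simp add: e_def index_mult_sum if_distrib[of "\<lambda>x. _ * x"] del: index_mult_mat(1) sum.lessThan_Suc cong: if_cong)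
    then show ?thesis by (simp add: sum.If_cases)
  qed
  have sm: "adj W * (c \<cdot>\<^sub>m (W * e)) = c \<cdot>\<^sub>m e" if W: "is_unitary (Suc n) W" for W c
    using is_unitaryD[OF W] e unitary_cancel[OF W, of e]
    by (subst mult_smult_distrib[of _ "Suc n" "Suc n" _ 1]) auto
  have "C * e = s \<cdot>\<^sub>m e"
    using d e sm[OF U] by (simp add: C_def assoc_mult_mat_dim col)
  then have c0: "C $$ (i, 0) = (if i = 0 then s else 0)" if "i < Suc n" for i
    using ix[OF C that] that by (auto simp: e_def)
  have "adj C * e = cnj s \<cdot>\<^sub>m e"
    using d e sm[OF V] by (simp add: C_def adj_mult assoc_mult_mat_dim row)
  then have "cnj (C $$ (0, i)) = (if i = 0 then cnj s else 0)" if "i < Suc n" for i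
    using ix[OF adj_carrier[OF C] that] that C by (auto simp: e_def)
  then have r0: "C $$ (0, i) = (if i = 0 then s else 0)" if "i < Suc n" for i
    using that by (metis complex_cnj_cnj complex_cnj_zero)
  define B where "B = mat n n (\<lambda>(i, j). C $$ (Suc i, Suc j))"
  have "C = four_block_mat (mat 1 1 (\<lambda>_. s)) (0\<^sub>m 1 n) (0\<^sub>m n 1) B"
    using C c0 r0 by (intro eq_matI) (auto simp: B_def)
  then show thesis by (intro that[of B]) (auto simp: B_def C_def)
qed

lemma four_block_conjugation:
  fixes A :: "'a :: {comm_ring_1, conjugatable_ring} mat"
  assumes "A \<in> carrier_mat m m" "B \<in> carrier_mat n n" "is_unitary m U1" "is_unitary m V1"
    "is_unitary n U2" "is_unitary n V2"
  shows "adj (four_block_mat U1 (0\<^sub>m m n) (0\<^sub>m n m) U2) * four_block_mat A (0\<^sub>m m n) (0\<^sub>m n m) B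
      * four_block_mat V1 (0\<^sub>m m n) (0\<^sub>m n m) V2
    = four_block_mat (adj U1 * A * V1) (0\<^sub>m m n) (0\<^sub>m n m) (adj U2 * B * V2)"
proof -
  note c = assms(1,2) assms(3-6)[THEN is_unitaryD(1)]
  have "adj U1 * A \<in> carrier_mat m m" "adj U2 * B \<in> carrier_mat n n"
    "adj U1 * A * V1 \<in> carrier_mat m m" "adj U2 * B * V2 \<in> carrier_mat n n"
    using c by auto
  with c show ?thesis
    by (simp add: adj_four_block[of _ m m _ n _ n] mult_four_block_mat[of _ m m _ n _ n _ _ m _ n])
qed

text \<open>The induction step common to the singular value decomposition and the spectral theorem:
  the unitaries found for the smaller block are bordered by a 1, and \<open>case_nat\<close> puts
  the new value in front.\<close>

lemma deflation_diag_step: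
  fixes A :: "'a :: {comm_ring_1, conjugatable_ring} mat" and n :: nat
  assumes A: "A \<in> carrier_mat (Suc n) (Suc n)"
    and U: "is_unitary (Suc n) U" and V: "is_unitary (Suc n) V"
    and U': "is_unitary n U'" and V': "is_unitary n V'"
    and B: "B \<in> carrier_mat n n" "adj U' * B * V' = mat_diag n d"
    and AB: "adj U * A * V = four_block_mat (mat 1 1 (\<lambda>_. s)) (0\<^sub>m 1 n) (0\<^sub>m n 1) B"
  defines "E \<equiv> \<lambda>X :: 'a mat. four_block_mat (1\<^sub>m 1) (0\<^sub>m 1 n) (0\<^sub>m n 1) X"
  shows "adj (U * E U') * A * (V * E V') = mat_diag (Suc n) (case_nat s d)"
    and "is_unitary (Suc n) (U * E U')" "is_unitary (Suc n) (V * E V')"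
proof -
  have E: "is_unitary (Suc n) (E U')" "is_unitary (Suc n) (E V')"
    using is_unitary_four_block[OF is_unitary_one U', of 1]
      is_unitary_four_block[OF is_unitary_one V', of 1] by (simp_all add: E_def)
  show "is_unitary (Suc n) (U * E U')" "is_unitary (Suc n) (V * E V')"
    by (intro is_unitary_mult U V E)+
  note d = is_unitaryD[OF U] is_unitaryD[OF V] is_unitaryD[OF E(1)] is_unitaryD[OF E(2)] carrier_matD[OF A]
  have "adj (U * E U') * A * (V * E V') = adj (E U') * (adj U * A * V) * E V'"
    using d by (simp add: adj_mult assoc_mult_mat_dim)
  also have "\<dots> = four_block_mat (adj (1\<^sub>m 1) * (mat 1 1 (\<lambda>_. s)) * 1\<^sub>m 1) (0\<^sub>m 1 n) (0\<^sub>m n 1) (mat_diag n d)"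
    unfolding AB E_def B(2)[symmetric]
    by (intro four_block_conjugation B is_unitary_one U' V') auto
  also have "\<dots> = mat_diag (Suc n) (case_nat s d)"
    by (intro eq_matI) (auto simp: mat_diag_def split: nat.splits)
  finally show "adj (U * E U') * A * (V * E V') = mat_diag (Suc n) (case_nat s d)" .
qed

text \<open>If both \<open>A\<^sup>*A\<close> and \<open>AA\<^sup>*\<close> are singular on the chosen eigenvectors, these already form a pair
  for the singular value \<open>0\<close>; otherwise one of them determines its partner.\<close>

lemma obtain_singular_pair:
  fixes A :: "complex mat"
  assumes A: "A \<in> carrier_mat n n" and n: "n > 0"
  obtains x y s where "x \<in> carrier_mat n 1" "adj x * x = 1\<^sub>m 1" "y \<in> carrier_mat n 1" "adj y * y = 1\<^sub>m 1"
    "s \<ge> 0" "A * x = complex_of_real s \<cdot>\<^sub>m y" "adj A * y = complex_of_real s \<cdot>\<^sub>m x"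
proof -
  have *: "A * x = 0\<^sub>m n 1 \<or> (\<exists>y s. y \<in> carrier_mat n 1 \<and> adj y * y = 1\<^sub>m 1 \<and> s \<ge> 0 \<and>
      A * x = complex_of_real s \<cdot>\<^sub>m y \<and> adj A * y = complex_of_real s \<cdot>\<^sub>m x)"
    if A: "A \<in> carrier_mat n n" and x: "x \<in> carrier_mat n 1" and u: "adj x * x = 1\<^sub>m 1"
      and ev: "(adj A * A) * x = l \<cdot>\<^sub>m x" for A x l
  proof -
    define z where "z = A * x"
    note dim = carrier_matD[OF A] carrier_matD[OF x]
    have z: "z \<in> carrier_mat n 1" using A x by (simp add: z_def)
    define q where "q = (\<Sum>k<n. (cmod (z $$ (k, 0)))\<^sup>2)"
    have q0: "q \<ge> 0" by (auto simp: q_def intro: sum_nonneg)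
    have "adj z * z = adj x * (l \<cdot>\<^sub>m x)"
      using dim by (simp add: z_def adj_mult assoc_mult_mat_dim ev[symmetric])
    also have "\<dots> = l \<cdot>\<^sub>m 1\<^sub>m 1"
      using x u by (subst mult_smult_distrib[of _ 1 n _ 1]) auto
    finally have zz: "adj z * z = l \<cdot>\<^sub>m 1\<^sub>m 1" .
    have lq: "l = complex_of_real q"
      using adj_mult_self_index[of 0 z] z unfolding zz by (simp add: q_def)
    show ?thesis
    proof (cases "q = 0")
      case True
      then have "adj z * z = 0\<^sub>m 1 1" unfolding zz lq by (intro eq_matI) auto
      then show ?thesis using adj_mult_self_eq_0[of z] carrier_matD[OF z] by (simp add: z_def)
    next
      case False
      \<comment> \<open>\<open>q\<close> is both the eigenvalue of \<open>adj A * A\<close> at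
        \<open>x\<close> and the squared norm of \<open>A * x\<close>, so \<open>s\<close> is the
        singular value and \<open>y\<close> the normalized image.\<close>
      define s where "s = sqrt q"
      have s: "s > 0" "s * s = q" using False q0 by (auto simp: s_def)
      define y where "y = complex_of_real (1 / s) \<cdot>\<^sub>m z"
      have y: "y \<in> carrier_mat n 1" using z by (simp add: y_def)
      have "adj y * y = (complex_of_real (1 / s) * complex_of_real (1 / s)) \<cdot>\<^sub>m (adj z * z)"
        unfolding y_def adj_smult using z
        by (auto simp: mult_smult_assoc_mat[of _ 1 n _ 1] mult_smult_distrib[of _ 1 n _ 1])
      also have "\<dots> = 1\<^sub>m 1"
        unfolding zz lq s(2)[symmetric] using s(1) by (intro eq_matI) (auto simp flip: of_real_mult)
      finally have "adj y * y = 1\<^sub>m 1" .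
      moreover have "A * x = complex_of_real s \<cdot>\<^sub>m y"
        unfolding y_def z_def using A x s by (intro eq_matI) (auto simp del: index_mult_mat(1))
      moreover have "adj A * y = complex_of_real (1 / s) \<cdot>\<^sub>m (adj A * z)"
        unfolding y_def using A z by (intro mult_smult_distrib[of _ n n _ 1]) auto
      moreover have "adj A * z = l \<cdot>\<^sub>m x" unfolding z_def ev[symmetric] using dim by (simp add: assoc_mult_mat_dim)
      moreover have "complex_of_real (1 / s) \<cdot>\<^sub>m (l \<cdot>\<^sub>m x) = complex_of_real s \<cdot>\<^sub>m x"
        unfolding lq s(2)[symmetric] using s(1) by (intro eq_matI) auto
      ultimately show ?thesis using y s(1) by (intro disjI2 exI[of _ y] exI[of _ s]) auto
    qed
  qed
  have c: "adj A * A \<in> carrier_mat n n" "adj (adj A) * adj A \<in> carrier_mat n n" using A by auto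
  obtain x l where x: "x \<in> carrier_mat n 1" "adj x * x = 1\<^sub>m 1" "(adj A * A) * x = l \<cdot>\<^sub>m x"
    using obtain_unit_eigenvector[OF c(1) n] by blast
  obtain y m where y: "y \<in> carrier_mat n 1" "adj y * y = 1\<^sub>m 1" "(adj (adj A) * adj A) * y = m \<cdot>\<^sub>m y"
    using obtain_unit_eigenvector[OF c(2) n] by blast
  have "0\<^sub>m n 1 = complex_of_real 0 \<cdot>\<^sub>m x" "0\<^sub>m n 1 = complex_of_real 0 \<cdot>\<^sub>m y"
    using x(1) y(1) by (auto intro!: eq_matI)
  \<comment> \<open>The auxiliary fact is used for \<open>A\<close> at \<open>x\<close> and for
    \<open>adj A\<close> at \<open>y\<close>; the second use exchanges the roles of the two
    vectors.\<close>
  then consider "A * x = complex_of_real 0 \<cdot>\<^sub>m y" "adj A * y = complex_of_real 0 \<cdot>\<^sub>m x"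
    | y s where "y \<in> carrier_mat n 1" "adj y * y = 1\<^sub>m 1" "s \<ge> 0"
      "A * x = complex_of_real s \<cdot>\<^sub>m y" "adj A * y = complex_of_real s \<cdot>\<^sub>m x"
    | x s where "x \<in> carrier_mat n 1" "adj x * x = 1\<^sub>m 1" "s \<ge> 0"
      "A * x = complex_of_real s \<cdot>\<^sub>m y" "adj A * y = complex_of_real s \<cdot>\<^sub>m x"
    using *[OF A x] *[OF adj_carrier[OF A] y] by (metis adj_adj)
  then show thesis
    by cases (use x y that[OF x(1,2) y(1,2), of 0] that[OF x(1,2)] that[OF _ _ y(1,2)] in auto)
qed

text \<open>Deflation at a singular pair. The values are left unordered here and are sorted
  afterwards by a permutation.\<close>

lemma complex_svd:
  fixes A :: "complex mat"
  assumes "A \<in> carrier_mat n n"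
  shows "\<exists>d. (\<forall>i. d i \<ge> 0) \<and> unit_equiv n A (mat_diag n (\<lambda>i. complex_of_real (d i)))"
  using assms
proof (induction n arbitrary: A)
  case 0
  then have "A = mat_diag 0 (\<lambda>i. complex_of_real 0)"
    by (intro eq_matI) (auto simp: mat_diag_def)
  with unit_equiv_refl[OF 0] show ?case
    by (intro exI[of _ "\<lambda>_. 0"]) simp
next
  case (Suc n)
  let ?e = "mat (Suc n) 1 (\<lambda>(i, _). if i = 0 then 1 else (0 :: complex))"
  obtain x y s where x: "x \<in> carrier_mat (Suc n) 1" "adj x * x = 1\<^sub>m 1"
    and y: "y \<in> carrier_mat (Suc n) 1" "adj y * y = 1\<^sub>m 1"
    and s: "s \<ge> 0" "A * x = complex_of_real s \<cdot>\<^sub>m y" "adj A * y = complex_of_real s \<cdot>\<^sub>m x"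
    using obtain_singular_pair[OF Suc.prems] by blast
  obtain U where U: "is_unitary (Suc n) U" "U * ?e = y" using obtain_unitary_first_column[OF y] .
  obtain V where V: "is_unitary (Suc n) V" "V * ?e = x" using obtain_unitary_first_column[OF x] .
  obtain B where B: "B \<in> carrier_mat n n"
    "adj U * A * V = four_block_mat (mat 1 1 (\<lambda>_. complex_of_real s)) (0\<^sub>m 1 n) (0\<^sub>m n 1) B"
    by (rule obtain_deflation[OF Suc.prems U(1) V(1), of "of_real s"]) (use U V s in auto)
  obtain d where d: "\<forall>i. d i \<ge> 0" "unit_equiv n B (mat_diag n (\<lambda>i. complex_of_real (d i)))"
    using Suc.IH[OF B(1)] by blast
  obtain U' V' where IH: "is_unitary n U'" "is_unitary n V'"
    "adj U' * B * V' = mat_diag n (\<lambda>i. complex_of_real (d i))"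
    by (rule unit_equivE[OF d(2)])
  have "case_nat (complex_of_real s) (\<lambda>i. complex_of_real (d i)) = (\<lambda>i. complex_of_real (case_nat s d i))"
    by (auto simp: fun_eq_iff split: nat.splits)
  then have "unit_equiv (Suc n) A (mat_diag (Suc n) (\<lambda>i. complex_of_real (case_nat s d i)))"
    using deflation_diag_step[OF Suc.prems U(1) V(1) IH(1,2) B(1) IH(3) B(2)] Suc.prems
    by (intro unit_equivI) auto
  then show ?case using s(1) d(1) by (intro exI[of _ "case_nat s d"]) (auto split: nat.splits)
qed

section \<open>Normal and commuting Hermitian matrices\<close>

lemma normal_eigenvector_adj:
  fixes A :: "complex mat"
  assumes A: "A \<in> carrier_mat n n" and normal: "A * adj A = adj A * A"
    and x: "x \<in> carrier_mat n 1" and ev: "A * x = l \<cdot>\<^sub>m x"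
  shows "adj A * x = cnj l \<cdot>\<^sub>m x"
proof -
  \<comment> \<open>As \<open>A\<close> commutes with its adjoint, \<open>A * z\<close> is again
    \<open>l\<close> times \<open>z\<close>. Moving \<open>adj A\<close> across then shows
    \<open>adj z * z = 0\<close>.\<close>
  define z where "z = adj A * x - cnj l \<cdot>\<^sub>m x"
  note dim = carrier_matD[OF A] carrier_matD[OF x]
  have z: "z \<in> carrier_mat n 1" using A x by (intro carrier_matI) (auto simp: z_def)
  have "A * (adj A * x) = adj A * (A * x)"
    using dim by (simp add: assoc_mult_mat_dim[symmetric] normal)
  also have "\<dots> = l \<cdot>\<^sub>m (adj A * x)"
    unfolding ev using A x by (intro mult_smult_distrib[of _ n n _ 1]) auto
  finally have "A * z = l \<cdot>\<^sub>m (adj A * x) - cnj l \<cdot>\<^sub>m (l \<cdot>\<^sub>m x)"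
    unfolding z_def using A x ev
    by (subst mult_minus_distrib_mat[of _ n n _ 1]) (auto simp: mult_smult_distrib[of A n n x 1])
  also have "\<dots> = l \<cdot>\<^sub>m z"
    using dim by (intro eq_matI) (auto simp: z_def algebra_simps simp del: index_mult_mat(1))
  finally have Az: "A * z = l \<cdot>\<^sub>m z" .
  have "adj x * (A * z) = l \<cdot>\<^sub>m (adj x * z)"
    unfolding Az using x z by (intro mult_smult_distrib[of _ 1 n _ 1]) auto
  moreover have "adj z * z = adj x * (A * z) - l \<cdot>\<^sub>m (adj x * z)"
  proof -
    have "adj z = adj x * A - l \<cdot>\<^sub>m adj x"
    proof -
      have "adj x * A = adj (adj A * x)" using dim by (simp add: adj_mult)
      then show ?thesis
        using dim A x conjugate_dist_add[where 'a = complex] 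
        by (intro eq_matI) (auto simp: z_def simp del: index_mult_mat(1))
    qed
    moreover have "(adj x * A - l \<cdot>\<^sub>m adj x) * z = adj x * A * z - (l \<cdot>\<^sub>m adj x) * z"
      using A x z by (intro minus_mult_distrib_mat[of _ 1 n _ _ 1]) auto
    moreover have "(l \<cdot>\<^sub>m adj x) * z = l \<cdot>\<^sub>m (adj x * z)"
      using x z by (intro mult_smult_assoc_mat[of _ 1 n _ 1]) auto
    ultimately show ?thesis
      using dim carrier_matD[OF z] by (simp add: assoc_mult_mat_dim)
  qed
  ultimately have "adj z * z = 0\<^sub>m 1 1" using x z by (intro eq_matI) auto
  then have "z = 0\<^sub>m n 1" using adj_mult_self_eq_0[of z] z by auto
  then show ?thesis
    unfolding z_def using dim by (auto simp: mat_eq_iff simp del: index_mult_mat(1))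
qed

text \<open>An eigenvector is at the same time one of the adjoint, so deflation works with the same
  unitary on both sides. The remaining block is again normal, by comparing lower right
  blocks.\<close>

lemma normal_diagonalizable:
  fixes A :: "complex mat"
  assumes "A \<in> carrier_mat n n" "A * adj A = adj A * A"
  shows "\<exists>U d. is_unitary n U \<and> adj U * A * U = mat_diag n d"
  using assms
proof (induction n arbitrary: A)
  case 0
  then show ?case
    by (intro exI[of _ "1\<^sub>m 0"] exI[of _ "\<lambda>_. 0"]) (auto simp: is_unitary_one mat_diag_def intro!: eq_matI)
next
  case (Suc n)
  let ?e = "mat (Suc n) 1 (\<lambda>(i, _). if i = 0 then 1 else (0 :: complex))"
  note A = Suc.prems(1)
  obtain x s where x: "x \<in> carrier_mat (Suc n) 1" "adj x * x = 1\<^sub>m 1" "A * x = s \<cdot>\<^sub>m x"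
    using obtain_unit_eigenvector[OF A] by blast
  obtain U where U: "is_unitary (Suc n) U" "U * ?e = x" using obtain_unitary_first_column[OF x(1,2)] .
  obtain B where B: "B \<in> carrier_mat n n"
    "adj U * A * U = four_block_mat (mat 1 1 (\<lambda>_. s)) (0\<^sub>m 1 n) (0\<^sub>m n 1) B"
    by (rule obtain_deflation[OF A U(1) U(1), of s])
      (use U x normal_eigenvector_adj[OF A Suc.prems(2) x(1,3)] in auto)
  let ?C = "adj U * A * U"
  note dim = is_unitaryD[OF U(1)] carrier_matD[OF A]
  have "?C * adj ?C = adj U * (A * adj A) * U"
    using dim by (simp add: adj_mult assoc_mult_mat_dim unitary_cancel[OF U(1)])
  also have "\<dots> = adj ?C * ?C"
    unfolding Suc.prems(2)
    using dim by (simp add: adj_mult assoc_mult_mat_dim unitary_cancel[OF U(1)])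
  finally have N: "?C * adj ?C = adj ?C * ?C" .
  have "B * adj B = adj B * B"
  proof (intro eq_matI)
    fix i j assume "i < dim_row (adj B * B)" "j < dim_col (adj B * B)"
    then have ij: "i < n" "j < n" using B(1) by auto
    let ?S = "mat 1 1 (\<lambda>_. s)"
    have "?S * adj ?S \<in> carrier_mat 1 1" "adj ?S * ?S \<in> carrier_mat 1 1"
      "B * adj B \<in> carrier_mat n n" "adj B * B \<in> carrier_mat n n"
      using B(1) by auto
    then
    have "four_block_mat (?S * adj ?S) (0\<^sub>m 1 n) (0\<^sub>m n 1) (B * adj B) =
      four_block_mat (adj ?S * ?S) (0\<^sub>m 1 n) (0\<^sub>m n 1) (adj B * B)"
      using N B(1) unfolding B(2)
      by (simp add: adj_four_block[of _ 1 1 _ n _ n] mult_four_block_mat[of _ 1 1 _ n _ n _ _ 1 _ n])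
    from arg_cong[OF this, of "\<lambda>M. M $$ (Suc i, Suc j)"]
    show "(B * adj B) $$ (i, j) = (adj B * B) $$ (i, j)"
      using ij B(1) by (simp del: index_mult_mat(1))
  qed (use B(1) in auto)
  then obtain U' d where IH: "is_unitary n U'" "adj U' * B * U' = mat_diag n d"
    using Suc.IH[OF B(1)] by blast
  show ?case
    using deflation_diag_step[OF A U(1) U(1) IH(1,1) B(1) IH(2) B(2)] by blast
qed

lemma unit_equiv_four_block:
  fixes A1 A2 :: "'a :: {comm_ring_1, conjugatable_ring} mat"
  assumes "unit_equiv m A1 B1" "unit_equiv n A2 B2"
    and A: "A1 \<in> carrier_mat m m" "A2 \<in> carrier_mat n n"
  shows "unit_equiv (m + n) (four_block_mat A1 (0\<^sub>m m n) (0\<^sub>m n m) A2)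
    (four_block_mat B1 (0\<^sub>m m n) (0\<^sub>m n m) B2)"
proof -
  obtain U1 V1 where 1: "is_unitary m U1" "is_unitary m V1" "adj U1 * A1 * V1 = B1"
    by (rule unit_equivE[OF assms(1)])
  obtain U2 V2 where 2: "is_unitary n U2" "is_unitary n V2" "adj U2 * A2 * V2 = B2"
    by (rule unit_equivE[OF assms(2)])
  show ?thesis
    by (rule unit_equivI[OF is_unitary_four_block[OF 1(1) 2(1)] is_unitary_four_block[OF 1(2) 2(2)]])
      (use A four_block_conjugation[OF A 1(1,2) 2(1,2)] 1(3) 2(3) in auto)
qed

lemma commuting_hermitian_diagonalizable:
  fixes H K :: "complex mat"
  assumes H: "H \<in> carrier_mat n n" "adj H = H" and K: "K \<in> carrier_mat n n" "adj K = K"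
    and comm: "H * K = K * H"
  obtains W a b where "is_unitary n W"
    "adj W * H * W = mat_diag n (\<lambda>i. complex_of_real (a i))"
    "adj W * K * W = mat_diag n (\<lambda>i. complex_of_real (b i))"
proof -
  define T where "T = H + \<i> \<cdot>\<^sub>m K"
  have T: "T \<in> carrier_mat n n" using H K by (simp add: T_def)
  have adjT: "adj T = H + (- \<i>) \<cdot>\<^sub>m K"
    unfolding T_def using H K by (subst adj_add[of _ n n]) (auto simp: adj_smult)
  have expand: "(H + c \<cdot>\<^sub>m K) * (H + e \<cdot>\<^sub>m K) = H * H + (c + e) \<cdot>\<^sub>m (H * K) + (c * e) \<cdot>\<^sub>m (K * K)" for c e
  proof -
    have "(H + c \<cdot>\<^sub>m K) * (H + e \<cdot>\<^sub>m K) = H * H + c \<cdot>\<^sub>m (K * H) + e \<cdot>\<^sub>m (K * H + c \<cdot>\<^sub>m (K * K))"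
      using H(1) K(1)
      by (simp add: add_mult_distrib_mat[of _ n n _ _ n] mult_add_distrib_mat[of _ n n _ n]
          mult_smult_distrib[of _ n n _ n] mult_smult_assoc_mat[of _ n n _ n] comm)
    also have "\<dots> = H * H + (c + e) \<cdot>\<^sub>m (H * K) + (c * e) \<cdot>\<^sub>m (K * K)"
      using H(1) K(1) by (intro eq_matI) (auto simp: comm algebra_simps simp del: index_mult_mat(1))
    finally show ?thesis .
  qed
  have "T * adj T = adj T * T"
    unfolding adjT unfolding T_def expand by (simp add: add.commute)
  then obtain W l where W: "is_unitary n W" and l: "adj W * T * W = mat_diag n l"
    using normal_diagonalizable[OF T] by blast
  define X where "X = adj W * H * W"
  define Y where "Y = adj W * K * W"
  note dim = is_unitaryD[OF W] carrier_matD[OF H(1)] carrier_matD[OF K(1)]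
  have XY: "X \<in> carrier_mat n n" "Y \<in> carrier_mat n n" using dim by (auto simp: X_def Y_def)
  have "adj X = X" "adj Y = Y"
    using dim by (auto simp: X_def Y_def adj_mult H(2) K(2) assoc_mult_mat_dim)
  then have herm: "cnj (X $$ (i, j)) = X $$ (j, i)" "cnj (Y $$ (i, j)) = Y $$ (j, i)"
    if "i < n" "j < n" for i j
    using XY that index_adj[of j X i] index_adj[of j Y i] by auto
  have "adj W * H \<in> carrier_mat n n" "adj W * K \<in> carrier_mat n n" using dim by auto
  then have "mat_diag n l = X + \<i> \<cdot>\<^sub>m Y"
    unfolding l[symmetric] X_def Y_def T_def
    using is_unitaryD(1)[OF W] H(1) K(1)
    by (simp add: add_mult_distrib_mat[of _ n n _ _ n] mult_add_distrib_mat[of _ n n _ n]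
        mult_smult_distrib[of _ n n _ n] mult_smult_assoc_mat[of _ n n _ n])
  then have sum: "X $$ (i, j) + \<i> * Y $$ (i, j) = (if i = j then l i else 0)" if "i < n" "j < n" for i j
    using that XY by (auto simp: mat_diag_def dest!: arg_cong[of _ _ "\<lambda>M. M $$ (i, j)"])
  \<comment> \<open>The \<open>(j, i)\<close> entry of the diagonal matrix, rewritten by Hermitian
    symmetry and conjugated, says X - \<i> Y = 0 at \<open>(i, j)\<close>; with X + \<i> Y = 0 both
    vanish.\<close>
  have off: "X $$ (i, j) = 0" "Y $$ (i, j) = 0" if "i < n" "j < n" "i \<noteq> j" for i j
  proof -
    have "X $$ (i, j) + \<i> * Y $$ (i, j) = 0" using sum[of i j] that by simp
    moreover have "cnj (X $$ (i, j)) + \<i> * cnj (Y $$ (i, j)) = 0"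
      using sum[of j i] that herm[of i j] by simp
    ultimately show "X $$ (i, j) = 0" "Y $$ (i, j) = 0"
      by (auto simp: complex_eq_iff)
  qed
  have real: "Im (X $$ (i, i)) = 0" "Im (Y $$ (i, i)) = 0" if "i < n" for i
    using herm[OF that that] by (simp_all add: complex_eq_iff)
  have "X = mat_diag n (\<lambda>i. complex_of_real (Re (X $$ (i, i))))"
    using XY off real by (intro eq_matI) (auto simp: mat_diag_def complex_eq_iff)
  moreover have "Y = mat_diag n (\<lambda>i. complex_of_real (Re (Y $$ (i, i))))"
    using XY off real by (intro eq_matI) (auto simp: mat_diag_def complex_eq_iff)
  ultimately show thesis by (rule that[OF W, folded X_def Y_def])
qed

section \<open>Diagonalization of dual matrices\<close>

lemma dual_number_simps [simp]:
  fixes a b :: "'a :: comm_ring_1 dual_number"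
  shows "std_part (0 :: 'a dual_number) = 0" "dual_part (0 :: 'a dual_number) = 0"
    "std_part (1 :: 'a dual_number) = 1" "dual_part (1 :: 'a dual_number) = 0"
    "std_part (a + b) = std_part a + std_part b" "dual_part (a + b) = dual_part a + dual_part b"
    "std_part (- a) = - std_part a" "dual_part (- a) = - dual_part a"
    "std_part (a * b) = std_part a * std_part b"
    "dual_part (a * b) = std_part a * dual_part b + dual_part a * std_part b"
  by (simp_all add: zero_dual_number_def one_dual_number_def plus_dual_number_def
      uminus_dual_number_def times_dual_number_def)

lemma dual_conjugate_simps [simp]:
  fixes a :: "'a :: {comm_ring_1, conjugatable_ring} dual_number"
  shows "std_part (conjugate a) = conjugate (std_part a)"
    "dual_part (conjugate a) = conjugate (dual_part a)"
  by (simp_all add: conjugate_dual_number_def)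

lemma complex_of_dual_simps [simp]:
  "std_part (complex_of_dual a) = of_real (std_part a)"
  "dual_part (complex_of_dual a) = of_real (dual_part a)"
  "complex_of_dual 0 = 0"
  by (simp_all add: complex_of_dual_def dual_number_eq_iff)

lemma dual_number_sum:
  fixes f :: "'b \<Rightarrow> 'a :: comm_ring_1 dual_number"
  shows "std_part (sum f S) = (\<Sum>x\<in>S. std_part (f x))" "dual_part (sum f S) = (\<Sum>x\<in>S. dual_part (f x))"
  by (induction S rule: infinite_finite_induct) auto

abbreviation std_mat :: "'a dual_number mat \<Rightarrow> 'a mat" where
  "std_mat \<equiv> map_mat std_part"

abbreviation inf_mat :: "'a dual_number mat \<Rightarrow> 'a mat" where
  "inf_mat \<equiv> map_mat dual_part"

definition dual_mat :: "'a mat \<Rightarrow> 'a mat \<Rightarrow> 'a dual_number mat" where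
  "dual_mat S D = mat (dim_row S) (dim_col S) (\<lambda>ij. Dual (S $$ ij) (D $$ ij))"

lemma dual_mat_dim [simp]: "dim_row (dual_mat S D) = dim_row S" "dim_col (dual_mat S D) = dim_col S"
  by (simp_all add: dual_mat_def)

lemma dual_mat_carrier [simp]: "S \<in> carrier_mat m n \<Longrightarrow> dual_mat S D \<in> carrier_mat m n"
  by (intro carrier_matI) auto

lemma index_dual_mat [simp]:
  "i < dim_row S \<Longrightarrow> j < dim_col S \<Longrightarrow> dual_mat S D $$ (i, j) = Dual (S $$ (i, j)) (D $$ (i, j))"
  by (simp add: dual_mat_def)

lemma dual_mat_parts: "dual_mat (std_mat A) (inf_mat A) = A"
  by (intro eq_matI) auto

lemma std_mat_mult:
  fixes A B :: "'a :: comm_ring_1 dual_number mat"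
  assumes "dim_col A = dim_row B"
  shows "std_mat (A * B) = std_mat A * std_mat B"
  using assms by (intro eq_matI) (auto simp: index_mult_sum dual_number_sum simp del: index_mult_mat(1))

lemma inf_mat_mult:
  fixes A B :: "'a :: comm_ring_1 dual_number mat"
  assumes "dim_col A = dim_row B"
  shows "inf_mat (A * B) = std_mat A * inf_mat B + inf_mat A * std_mat B"
  using assms
  by (intro eq_matI)
    (auto simp: index_mult_sum dual_number_sum sum.distrib simp del: index_mult_mat(1))

lemma dual_mat_mult:
  fixes S S' :: "'a :: comm_ring_1 mat"
  assumes "S \<in> carrier_mat l m" "D \<in> carrier_mat l m" "S' \<in> carrier_mat m n" "D' \<in> carrier_mat m n"
  shows "dual_mat S D * dual_mat S' D' = dual_mat (S * S') (S * D' + D * S')"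
proof -
  have "std_mat (dual_mat S D) = S" "std_mat (dual_mat S' D') = S'"
    "inf_mat (dual_mat S D) = D" "inf_mat (dual_mat S' D') = D'"
    using assms by (auto intro!: eq_matI)
  then show ?thesis
    using assms dual_mat_parts[of "dual_mat S D * dual_mat S' D'"]
    by (simp add: std_mat_mult inf_mat_mult)
qed

lemma adj_dual_mat:
  fixes S D :: "'a :: {comm_ring_1, conjugatable_ring} mat"
  assumes "S \<in> carrier_mat m n" "D \<in> carrier_mat m n"
  shows "adj (dual_mat S D) = dual_mat (adj S) (adj D)"
  using assms by (intro eq_matI) (auto simp: dual_number_eq_iff)

lemma dual_mat_one: "dual_mat (1\<^sub>m n) (0\<^sub>m n n) = (1\<^sub>m n :: 'a :: comm_ring_1 dual_number mat)"
  by (intro eq_matI) (auto simp: dual_number_eq_iff)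

lemma is_unitary_dual_mat:
  fixes U :: "'a :: {comm_ring_1, conjugatable_ring} mat"
  assumes "is_unitary n U"
  shows "is_unitary n (dual_mat U (0\<^sub>m n n))"
  using is_unitaryD[OF assms]
  by (simp add: is_unitary_def adj_dual_mat[of _ n n] dual_mat_mult[of _ n n _ _ n] dual_mat_one)

text \<open>As \<epsilon> squares to zero, the product with the adjoint is 1 + (\<open>adj P\<close>
  + \<open>P\<close>) \<epsilon>. These are the unitaries infinitely close to the identity.\<close>

lemma is_unitary_dual_mat_one:
  fixes P :: "'a :: {comm_ring_1, conjugatable_ring} mat"
  assumes P: "P \<in> carrier_mat n n" and skew: "adj P = - P"
  shows "is_unitary n (dual_mat (1\<^sub>m n) P)"
proof -
  have "P + - P = 0\<^sub>m n n" "- P + P = 0\<^sub>m n n"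
    using P by (auto intro!: eq_matI)
  then show ?thesis
    using P
    by (simp add: is_unitary_def adj_dual_mat[of _ n n] dual_mat_mult[of _ n n _ _ n] skew dual_mat_one)
qed

lemma dual_mat_conjugation:
  fixes S :: "'a :: {comm_ring_1, conjugatable_ring} mat"
  assumes S: "S \<in> carrier_mat n n" "D \<in> carrier_mat n n"
    and U: "U \<in> carrier_mat n n" and V: "V \<in> carrier_mat n n"
  shows "adj (dual_mat U (0\<^sub>m n n)) * dual_mat S D * dual_mat V (0\<^sub>m n n)
    = dual_mat (adj U * S * V) (adj U * D * V)"
proof -
  have "adj U * S \<in> carrier_mat n n" "adj U * D \<in> carrier_mat n n"
    "adj U * S * V \<in> carrier_mat n n" "adj U * D * V \<in> carrier_mat n n" using assms by auto
  then show ?thesis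
    using assms by (simp add: adj_dual_mat[of _ n n] dual_mat_mult[of _ n n _ _ n])
qed

lemma dual_mat_diag:
  "dual_mat (mat_diag n (\<lambda>i. complex_of_real (a i))) (mat_diag n (\<lambda>i. complex_of_real (b i)))
    = mat_diag n (\<lambda>i. complex_of_dual (Dual (a i) (b i)))"
  by (intro eq_matI) (auto simp: mat_diag_def complex_of_dual_def zero_dual_number_def)

text \<open>Transforming by \<open>I + P \<epsilon>\<close> and \<open>I + Q \<epsilon>\<close> with \<open>P\<close>, \<open>Q\<close> skew-Hermitian changes the
  infinitesimal part \<open>C\<close> to \<open>C - P D + D Q\<close>. The entries of \<open>P\<close> and \<open>Q\<close> below solve the linear
  equations which make the \<open>(i, j)\<close> and \<open>(j, i)\<close> entries vanish when \<open>d i \<noteq> d j\<close>, and conjugate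
  when \<open>d i = d j\<close>; in the latter case the formula for \<open>P\<close> has the value \<open>x / 0 = 0\<close>.\<close>

lemma unit_equiv_dual_mat_diag_reduce:
  fixes C :: "complex mat"
  assumes C: "C \<in> carrier_mat n n" and nonneg: "\<And>i. d i \<ge> (0 :: real)"
  defines "D \<equiv> mat_diag n (\<lambda>i. complex_of_real (d i))"
  obtains C' where "C' \<in> carrier_mat n n" "unit_equiv n (dual_mat D C) (dual_mat D C')"
    "\<And>i j. i < n \<Longrightarrow> j < n \<Longrightarrow> d i \<noteq> d j \<Longrightarrow> C' $$ (i, j) = 0"
    "\<And>i j. i < n \<Longrightarrow> j < n \<Longrightarrow> d i = d j \<Longrightarrow> d i \<noteq> 0 \<Longrightarrow> C' $$ (j, i) = cnj (C' $$ (i, j))"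
proof -
  define p where "p i j = (d j * C $$ (i, j) + d i * cnj (C $$ (j, i))) / complex_of_real (d j * d j - d i * d i)"
    for i j
  \<comment> \<open>For \<open>d i = d j\<close> nonzero this replaces the entry by the mean of
    \<open>C $$ (i, j)\<close> and \<open>cnj (C $$ (j, i))\<close>. For
    \<open>d i = d j = 0\<close> division by zero gives 0, and the entry stays as it is.\<close>
  define q where "q i j = (if d i = d j then (cnj (C $$ (j, i)) - C $$ (i, j)) / complex_of_real (2 * d i)
      else (d i * C $$ (i, j) + d j * cnj (C $$ (j, i))) / complex_of_real (d j * d j - d i * d i))" for i j
  define P where "P = mat n n (\<lambda>(i, j). p i j)"
  define Q where "Q = mat n n (\<lambda>(i, j). q i j)"
  define C' where "C' = D * Q + (C - P * D)"
  have PQ: "P \<in> carrier_mat n n" "Q \<in> carrier_mat n n" by (auto simp: P_def Q_def)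
  have D: "D \<in> carrier_mat n n" by (simp add: D_def)
  have C': "C' \<in> carrier_mat n n" using PQ C D by (intro carrier_matI) (auto simp: C'_def)
  \<comment> \<open>Nonnegativity excludes \<open>d i = - d j\<close>, so different values have
    different squares.\<close>
  have sq: "complex_of_real (d j * d j - d i * d i) \<noteq> 0" if "d i \<noteq> d j" for i j
    using that nonneg[of i] nonneg[of j] by (auto simp: square_eq_iff simp del: of_real_diff of_real_mult)
  have "cnj (p j i) = - p i j" for i j
    by (cases "d i = d j") (use sq[of i j] sq[of j i] in \<open>auto simp: p_def field_simps\<close>)
  then have P: "adj P = - P" by (intro eq_matI) (auto simp: P_def)
  have "cnj (q j i) = - q i j" for i j
    by (cases "d i = d j"; cases "d i = 0") (use sq[of i j] sq[of j i] in \<open>auto simp: q_def field_simps\<close>)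
  then have Q: "adj Q = - Q" by (intro eq_matI) (auto simp: Q_def)
  have "adj (dual_mat (1\<^sub>m n) P) * dual_mat D C * dual_mat (1\<^sub>m n) Q = dual_mat D (D * Q + (C + (- P) * D))"
    using C D PQ by (simp add: adj_dual_mat[of _ n n] dual_mat_mult[of _ n n _ _ n] P)
  also have "C + (- P) * D = C - P * D"
    using C D PQ by (intro eq_matI) (auto)
  finally have "unit_equiv n (dual_mat D C) (dual_mat D C')"
    using D unfolding C'_def
    by (intro unit_equivI[OF is_unitary_dual_mat_one[OF PQ(1) P] is_unitary_dual_mat_one[OF PQ(2) Q]]) auto
  moreover have entry: "C' $$ (i, j) = d i * q i j + (C $$ (i, j) - p i j * d j)" if "i < n" "j < n" for i j
    unfolding C'_def D_def mat_diag_mult_left[OF PQ(2)] mat_diag_mult_right[OF PQ(1)]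
    using that C by (simp add: P_def Q_def)
  have "C' $$ (i, j) = 0" if "i < n" "j < n" "d i \<noteq> d j" for i j
    unfolding entry[OF that(1,2)] using that(3) sq[OF that(3)] by (simp add: p_def q_def field_simps)
  moreover have "C' $$ (j, i) = cnj (C' $$ (i, j))" if "i < n" "j < n" "d i = d j" "d i \<noteq> 0" for i j
    using that by (simp add: entry p_def q_def field_simps)
  ultimately show thesis using that[OF C'] by blast
qed

text \<open>No sign or order of the diagonal is claimed; both are arranged later.\<close>

lemma dual_mat_diagonalizable:
  fixes A :: "complex_dual mat"
  assumes A: "A \<in> carrier_mat n n"
  shows "\<exists>\<mu>. unit_equiv n A (mat_diag n (\<lambda>i. complex_of_dual (\<mu> i)))"
proof -
  have "std_mat A \<in> carrier_mat n n" using A by simp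
  then obtain d0 where d0: "\<forall>i. d0 i \<ge> 0"
    "unit_equiv n (std_mat A) (mat_diag n (\<lambda>i. complex_of_real (d0 i)))"
    using complex_svd by blast
  \<comment> \<open>Sorting makes the nonzero values an initial segment, which is what allows the
    split into two blocks at \<open>r\<close>.\<close>
  obtain \<pi> where \<pi>: "bij_betw \<pi> {..<n} {..<n}" "\<And>i j. i \<le> j \<Longrightarrow> j < n \<Longrightarrow> d0 (\<pi> j) \<le> d0 (\<pi> i)"
    using obtain_descending_permutation[of n d0] by blast
  define d where "d = d0 \<circ> \<pi>"
  have d: "d i \<ge> 0" for i using d0 by (simp add: d_def)
  let ?D = "mat_diag n (\<lambda>i. complex_of_real (d i))"
  have "unit_equiv n (std_mat A) ?D"
    using unit_equiv_trans[OF d0(2) unit_equiv_permute[OF \<pi>(1)]] by (simp add: d_def o_def)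
  then obtain U V where U: "is_unitary n U" and V: "is_unitary n V" and D: "adj U * std_mat A * V = ?D"
    by (rule unit_equivE)
  define C where "C = adj U * inf_mat A * V"
  have C: "C \<in> carrier_mat n n" using is_unitaryD[OF U] is_unitaryD[OF V] A by (auto simp: C_def)
  have 1: "unit_equiv n A (dual_mat ?D C)"
    using dual_mat_conjugation[of "std_mat A" n "inf_mat A" U V] A is_unitaryD[OF U] is_unitaryD[OF V]
    by (intro unit_equivI[OF is_unitary_dual_mat[OF U] is_unitary_dual_mat[OF V]])
      (auto simp: dual_mat_parts D C_def)
  obtain C' where C': "C' \<in> carrier_mat n n" and 2: "unit_equiv n (dual_mat ?D C) (dual_mat ?D C')"
    and off: "\<And>i j. i < n \<Longrightarrow> j < n \<Longrightarrow> d i \<noteq> d j \<Longrightarrow> C' $$ (i, j) = 0"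
    and herm: "\<And>i j. i < n \<Longrightarrow> j < n \<Longrightarrow> d i = d j \<Longrightarrow> d i \<noteq> 0 \<Longrightarrow> C' $$ (j, i) = cnj (C' $$ (i, j))"
    using unit_equiv_dual_mat_diag_reduce[OF C, of d] d by metis
  obtain r where r: "r \<le> n" "\<And>i. i < n \<Longrightarrow> d i \<noteq> 0 \<longleftrightarrow> i < r"
    using obtain_threshold[of n "\<lambda>i. d i \<noteq> 0"] \<pi>(2) d by (metis comp_apply d_def order_antisym)
  define m where "m = n - r"
  have n: "n = r + m" using r by (simp add: m_def)
  define D1 where "D1 = mat_diag r (\<lambda>i. complex_of_real (d i))"
  define C1 where "C1 = mat r r (\<lambda>(i, j). C' $$ (i, j))"
  define C2 where "C2 = mat m m (\<lambda>(i, j). C' $$ (r + i, r + j))"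
  have c: "D1 \<in> carrier_mat r r" "C1 \<in> carrier_mat r r" "C2 \<in> carrier_mat m m"
    by (auto simp: D1_def C1_def C2_def)
  have off': "C' $$ (i, j) = 0" if "i < n" "j < n" "(i < r) \<noteq> (j < r)" for i j
    using that off r(2) by metis
  have split: "dual_mat ?D C'
      = four_block_mat (dual_mat D1 C1) (0\<^sub>m r m) (0\<^sub>m m r) (dual_mat (0\<^sub>m m m) C2)"
    using r(2) off' n
    by (intro eq_matI) (auto simp: D1_def C1_def C2_def mat_diag_def dual_number_eq_iff)
  have "adj D1 = D1" by (simp add: D1_def adj_mat_diag)
  moreover have "adj C1 = C1"
  proof (intro eq_matI)
    fix i j assume "i < dim_row C1" "j < dim_col C1"
    then have ij: "i < n" "j < n" "i < r" "j < r" using r by (auto simp: C1_def)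
    then have "C' $$ (i, j) = cnj (C' $$ (j, i))"
      using herm[of j i] off[of i j] off[of j i] r(2)[of j] by (cases "d i = d j") auto
    then show "adj C1 $$ (i, j) = C1 $$ (i, j)" using ij by (simp add: C1_def)
  qed (auto simp: C1_def)
  \<comment> \<open>Entrywise, either the two diagonal values agree or the entry of
    \<open>C1\<close> is zero.\<close>
  moreover have "D1 * C1 = C1 * D1"
    unfolding D1_def mat_diag_mult_left[OF c(2)] mat_diag_mult_right[OF c(2)]
    using off r(1) by (intro eq_matI) (auto simp: C1_def)
  ultimately obtain W a b where W: "is_unitary r W"
    "adj W * D1 * W = mat_diag r (\<lambda>i. complex_of_real (a i))"
    "adj W * C1 * W = mat_diag r (\<lambda>i. complex_of_real (b i))"
    using commuting_hermitian_diagonalizable[OF c(1) _ c(2)] by metis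
  have 3: "unit_equiv r (dual_mat D1 C1) (mat_diag r (\<lambda>i. complex_of_dual (Dual (a i) (b i))))"
    using dual_mat_conjugation[OF c(1,2) is_unitaryD(1)[OF W(1)] is_unitaryD(1)[OF W(1)]] c
    by (intro unit_equivI[OF is_unitary_dual_mat[OF W(1)] is_unitary_dual_mat[OF W(1)]])
      (auto simp: W(2,3) dual_mat_diag)
  \<comment> \<open>The standard part of this block is zero and stays zero under any unitaries, so
    \<open>C2\<close> may be transformed differently on its two sides.\<close>
  obtain s where "unit_equiv m C2 (mat_diag m (\<lambda>i. complex_of_real (s i)))"
    using complex_svd[OF c(3)] by blast
  then obtain X Y where XY: "is_unitary m X" "is_unitary m Y"
    "adj X * C2 * Y = mat_diag m (\<lambda>i. complex_of_real (s i))"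
    by (rule unit_equivE)
  \<comment> \<open>Writing the zero matrix with \<open>complex_of_real 0\<close> makes it match
    \<open>dual_mat_diag\<close>.\<close>
  have "adj X * 0\<^sub>m m m * Y = mat_diag m (\<lambda>i. complex_of_real 0)"
    using is_unitaryD[OF XY(1)] is_unitaryD[OF XY(2)]
    by (simp add: right_mult_zero_mat[of _ m m] left_mult_zero_mat[of _ m m]) (auto simp: mat_diag_def)
  then have 4: "unit_equiv m (dual_mat (0\<^sub>m m m) C2) (mat_diag m (\<lambda>i. complex_of_dual (Dual 0 (s i))))"
    using dual_mat_conjugation[OF zero_carrier_mat c(3) is_unitaryD(1)[OF XY(1)] is_unitaryD(1)[OF XY(2)]] c
    by (intro unit_equivI[OF is_unitary_dual_mat[OF XY(1)] is_unitary_dual_mat[OF XY(2)]])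
      (auto simp: XY(3) dual_mat_diag simp del: of_real_0)
  define \<mu> where "\<mu> i = (if i < r then Dual (a i) (b i) else Dual 0 (s (i - r)))" for i
  have "mat_diag n (\<lambda>i. complex_of_dual (\<mu> i))
    = four_block_mat (mat_diag r (\<lambda>i. complex_of_dual (Dual (a i) (b i)))) (0\<^sub>m r m) (0\<^sub>m m r)
        (mat_diag m (\<lambda>i. complex_of_dual (Dual 0 (s i))))"
    unfolding n by (intro eq_matI) (auto simp: mat_diag_def \<mu>_def)
  then have "unit_equiv n (dual_mat ?D C') (mat_diag n (\<lambda>i. complex_of_dual (\<mu> i)))"
    using unit_equiv_four_block[OF 3 4] c unfolding split by (simp add: n)
  then show ?thesis using 1 2 unit_equiv_trans by blast
qed

section \<open>Singular value decomposition and essential part\<close>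

text \<open>Negative entries are flipped by a diagonal of signs on the right, which is its own
  adjoint and inverse.\<close>

lemma unit_equiv_dual_abs:
  "unit_equiv n (mat_diag n (\<lambda>i. complex_of_dual (\<mu> i)))
    (mat_diag n (\<lambda>i. complex_of_dual (if \<mu> i \<ge> 0 then \<mu> i else - \<mu> i)))"
proof -
  define V :: "complex_dual mat" where "V = mat_diag n (\<lambda>i. if \<mu> i \<ge> 0 then 1 else - 1)"
  have "conjugate (- 1 :: complex_dual) = - 1" by (simp add: conjugate_neg)
  then have "adj V = V"
    by (auto simp: V_def adj_mat_diag if_distrib[of conjugate] cong: if_cong)
  moreover have "V * V = 1\<^sub>m n"
    unfolding V_def mat_diag_diag by (intro eq_matI) (auto simp: mat_diag_def)
  ultimately have V: "is_unitary n V" by (auto simp: is_unitary_def V_def)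
  have "complex_of_dual (- a) = - complex_of_dual a" for a by (simp add: dual_number_eq_iff)
  then have "mat_diag n (\<lambda>i. complex_of_dual (\<mu> i)) * V
    = mat_diag n (\<lambda>i. complex_of_dual (if \<mu> i \<ge> 0 then \<mu> i else - \<mu> i))"
    unfolding V_def mat_diag_diag by (intro eq_matI) (auto simp: mat_diag_def)
  then show ?thesis
    by (intro unit_equivI[OF is_unitary_one V]) (auto simp: left_mult_one_mat[OF mat_diag_dim])
qed

definition svd_mat :: "nat \<Rightarrow> nat \<Rightarrow> nat \<Rightarrow> (nat \<Rightarrow> real_dual) \<Rightarrow> complex_dual mat" where
  "svd_mat n r t \<mu> = four_block_mat
     (complex_mat_of_dual (Sigma1_mat r \<mu>)) (0\<^sub>m r (n - r))
     (0\<^sub>m (n - r) r) (complex_mat_of_dual (Sigma2_mat n n r t \<mu>))"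

definition appreciable_svd_mat :: "nat \<Rightarrow> nat \<Rightarrow> (nat \<Rightarrow> real_dual) \<Rightarrow> complex_dual mat" where
  "appreciable_svd_mat n r \<mu> = four_block_mat
     (complex_mat_of_dual (Sigma1_mat r \<mu>)) (0\<^sub>m r (n - r))
     (0\<^sub>m (n - r) r) (0\<^sub>m (n - r) (n - r))"

lemma Sigma_carrier [simp]:
  "Sigma1_mat r \<mu> \<in> carrier_mat r r"
  "Sigma2_mat n n r t \<mu> \<in> carrier_mat (n - r) (n - r)"
  by (simp_all add: Sigma1_mat_def Sigma2_mat_def rect_diag_mat_def)

text \<open>The first block contributes all \<open>r\<close> entries whatever \<open>t\<close> is,
  hence the disjunction in the condition.\<close>

lemma svd_mat_eq_mat_diag:
  assumes "r \<le> n"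
  shows "svd_mat n r t \<mu> = mat_diag n (\<lambda>i. if i < r \<or> i < t then complex_of_dual (\<mu> i) else 0)"
    "appreciable_svd_mat n r \<mu> = mat_diag n (\<lambda>i. if i < r then complex_of_dual (\<mu> i) else 0)"
  using assms
  by (intro eq_matI;
      auto simp: svd_mat_def appreciable_svd_mat_def Sigma1_mat_def Sigma2_mat_def rect_diag_mat_def
        mat_diag_def)+

lemma is_svd_iff:
  assumes "A \<in> carrier_mat n n"
  shows "is_svd A r t \<mu> U V \<longleftrightarrow> r \<le> t \<and> t \<le> n \<and> singular_values r t \<mu> \<and>
    is_unitary n U \<and> is_unitary n V \<and> A = U * svd_mat n r t \<mu> * adj V"
  using assms
  by (auto simp: is_svd_def Let_def svd_mat_def unitary_mat_eq_is_unitary ctranspose_eq_adj)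

text \<open>For nonnegative values, descending lexicographic order puts appreciable ones first, then
  nonzero infinitesimal ones, then zeros; \<open>r\<close> and \<open>t\<close> are the two
  thresholds.\<close>

lemma svd_exists:
  fixes A :: "complex_dual mat"
  assumes A: "A \<in> carrier_mat n n"
  obtains r t \<mu> U V where "is_svd A r t \<mu> U V"
proof -
  obtain \<mu>0 where 0: "unit_equiv n A (mat_diag n (\<lambda>i. complex_of_dual (\<mu>0 i)))"
    using dual_mat_diagonalizable[OF A] by blast
  define \<mu>1 where "\<mu>1 i = (if \<mu>0 i \<ge> 0 then \<mu>0 i else - \<mu>0 i)" for i
  have 1: "unit_equiv n A (mat_diag n (\<lambda>i. complex_of_dual (\<mu>1 i)))"
    using unit_equiv_trans[OF 0 unit_equiv_dual_abs] by (simp add: \<mu>1_def)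
  obtain \<pi> where \<pi>: "bij_betw \<pi> {..<n} {..<n}" "\<And>i j. i \<le> j \<Longrightarrow> j < n \<Longrightarrow> \<mu>1 (\<pi> j) \<le> \<mu>1 (\<pi> i)"
    using obtain_descending_permutation[of n \<mu>1] by blast
  define \<mu> where "\<mu> = \<mu>1 \<circ> \<pi>"
  have anti: "\<mu> j \<le> \<mu> i" if "i \<le> j" "j < n" for i j using \<pi>(2)[OF that] by (simp add: \<mu>_def)
  have nonneg: "\<mu> i \<ge> 0" for i
    by (auto simp: \<mu>_def \<mu>1_def less_eq_dual_number_def less_dual_number_def dual_number_eq_iff)
  have "unit_equiv n A (mat_diag n (\<lambda>i. complex_of_dual (\<mu> i)))"
    using unit_equiv_trans[OF 1 unit_equiv_permute[OF \<pi>(1)]] by (simp add: \<mu>_def o_def)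
  then obtain U V where UV: "is_unitary n U" "is_unitary n V"
    "A = U * mat_diag n (\<lambda>i. complex_of_dual (\<mu> i)) * adj V" by (rule unit_equivE)
  have std_nonneg: "std_part (\<mu> i) \<ge> 0" for i
    using nonneg[of i] by (auto simp: less_eq_dual_number_def less_dual_number_def)
  have "std_part (\<mu> i) \<noteq> 0" if "i \<le> j" "j < n" "std_part (\<mu> j) \<noteq> 0" for i j
    using anti[OF that(1,2)] that(3) std_nonneg[of j]
    by (auto simp: less_eq_dual_number_def less_dual_number_def)
  then obtain r where r: "r \<le> n" "\<And>i. i < n \<Longrightarrow> std_part (\<mu> i) \<noteq> 0 \<longleftrightarrow> i < r"
    using obtain_threshold[of n "\<lambda>i. std_part (\<mu> i) \<noteq> 0"] by metis
  have "\<mu> i \<noteq> 0" if "i \<le> j" "j < n" "\<mu> j \<noteq> 0" for i j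
    using anti[OF that(1,2)] that(3) nonneg[of j] by auto
  then obtain t where t: "t \<le> n" "\<And>i. i < n \<Longrightarrow> \<mu> i \<noteq> 0 \<longleftrightarrow> i < t"
    using obtain_threshold[of n "\<lambda>i. \<mu> i \<noteq> 0"] by metis
  have rt: "r \<le> t"
  proof (rule ccontr)
    assume "\<not> r \<le> t"
    then have "t < r" "t < n" using r by auto
    then show False using r(2)[of t] t(2)[of t] by auto
  qed
  have "0 < \<mu> i" if "i < t" for i
    using nonneg[of i] t(2)[of i] t(1) that by (simp add: order.strict_iff_order)
  moreover have "std_part (\<mu> i) = 0" if "r \<le> i" "i < t" for i
    using r(2)[of i] t(1) that by auto
  ultimately have "singular_values r t \<mu>"
    unfolding singular_values_def appreciable_def infinitesimal_def
    using r t(1) rt anti by auto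
  moreover have "mat_diag n (\<lambda>i. complex_of_dual (\<mu> i)) = svd_mat n r t \<mu>"
  proof -
    have "complex_of_dual (\<mu> i) = 0" if "i < n" "\<not> i < t" for i using t(2)[of i] that by auto
    then show ?thesis
      unfolding svd_mat_eq_mat_diag[OF r(1)] using rt by (intro eq_matI) (auto simp: mat_diag_def)
  qed
  ultimately have "is_svd A r t \<mu> U V"
    unfolding is_svd_iff[OF A] using UV rt t(1) by auto
  then show thesis by (rule that)
qed

section \<open>Uniqueness of the essential part\<close>

text \<open>\<open>Z\<close> is a generalized inverse of \<open>E\<close>. The properties listed here already determine \<open>E\<close>.\<close>

lemma svd_split:
  assumes A: "A \<in> carrier_mat n n" and svd: "is_svd A r t \<mu> U V"
  obtains E N Z where "E = U * appreciable_svd_mat n r \<mu> * adj V"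
    "E \<in> carrier_mat n n" "N \<in> carrier_mat n n" "Z \<in> carrier_mat n n"
    "A = E + N" "std_mat N = 0\<^sub>m n n" "adj N * E = 0\<^sub>m n n" "E * adj N = 0\<^sub>m n n" "E * Z * E = E"
proof -
  note svd' = svd[unfolded is_svd_iff[OF A]]
  have rn: "r \<le> n" and rt: "r \<le> t" using svd' by auto
  have U: "is_unitary n U" and V: "is_unitary n V" using svd' by auto
  define e where "e i = (if i < r then complex_of_dual (\<mu> i) else 0)" for i
  define f where "f i = (if r \<le> i \<and> i < t then complex_of_dual (\<mu> i) else 0)" for i
  \<comment> \<open>The inverse of an appreciable a + b \<epsilon> is 1/a - (b/a^2)
    \<epsilon>.\<close>
  define z where "z i = (if i < r then Dual (1 / std_part (complex_of_dual (\<mu> i)))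
     (- dual_part (complex_of_dual (\<mu> i)) / (std_part (complex_of_dual (\<mu> i)))\<^sup>2) else 0)" for i
  have std: "std_part (\<mu> i) \<noteq> 0" if "i < r" for i
    using svd' that by (auto simp: singular_values_def appreciable_def)
  have eze: "e i * z i * e i = e i" for i
    using std[of i]
    by (auto simp: e_def z_def dual_number_eq_iff power2_eq_square field_simps)
  define D where "D = (mat_diag n :: _ \<Rightarrow> complex_dual mat)"
  have Dc: "dim_row (D g) = n" "dim_col (D g) = n" "D g \<in> carrier_mat n n" for g
    by (auto simp: D_def mat_diag_def)
  note dim = is_unitaryD[OF U] is_unitaryD[OF V] Dc
  have D0: "D (\<lambda>i. 0) = 0\<^sub>m n n" by (auto simp: D_def mat_diag_def)
  define E where "E = U * D e * adj V"
  define N where "N = U * D f * adj V"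
  define Z where "Z = V * D z * adj U"
  have carr: "E \<in> carrier_mat n n" "N \<in> carrier_mat n n" "Z \<in> carrier_mat n n"
    using dim by (auto simp: E_def N_def Z_def)
  have E: "E = U * appreciable_svd_mat n r \<mu> * adj V"
    by (simp add: E_def D_def e_def[abs_def] svd_mat_eq_mat_diag[OF rn])
  have "svd_mat n r t \<mu> = D e + D f"
    unfolding svd_mat_eq_mat_diag[OF rn] D_def using rt
    by (intro eq_matI) (auto simp: mat_diag_def e_def f_def)
  then have "A = U * (D e + D f) * adj V" using svd' by simp
  also have "\<dots> = E + N"
    unfolding E_def N_def using dim
    by (simp add: mult_add_distrib_mat[of U n n "D e" n "D f"]
      add_mult_distrib_mat[of "U * D e" n n "U * D f" "adj V" n])
  finally have AE: "A = E + N" .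
  have "std_mat (D f) = 0\<^sub>m n n"
    using svd' by (intro eq_matI) (auto simp: D_def f_def mat_diag_def singular_values_def infinitesimal_def)
  then have N0: "std_mat N = 0\<^sub>m n n"
    unfolding N_def using dim
    by (simp add: std_mat_mult left_mult_zero_mat[of _ n n] right_mult_zero_mat[of _ n n])
  have adjf: "adj (D f) = D (\<lambda>i. conjugate (f i))" by (simp add: D_def adj_mat_diag)
  have "adj N * E = V * (adj (D f) * D e) * adj V"
    unfolding N_def E_def using dim by (simp add: adj_mult assoc_mult_mat_dim unitary_cancel[OF U])
  also have "adj (D f) * D e = 0\<^sub>m n n"
    unfolding adjf D0[symmetric] by (simp add: D_def) (intro eq_matI; auto simp: mat_diag_def e_def f_def)
  finally have 1: "adj N * E = 0\<^sub>m n n" using dim by simp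
  have "E * adj N = U * (D e * adj (D f)) * adj U"
    unfolding N_def E_def using dim by (simp add: adj_mult assoc_mult_mat_dim unitary_cancel[OF V])
  also have "D e * adj (D f) = 0\<^sub>m n n"
    unfolding adjf D0[symmetric] by (simp add: D_def) (intro eq_matI; auto simp: mat_diag_def e_def f_def)
  finally have 2: "E * adj N = 0\<^sub>m n n" using dim by simp
  have "E * Z * E = U * (D e * (D z * D e)) * adj V"
    unfolding E_def Z_def using dim
    by (simp add: assoc_mult_mat_dim unitary_cancel[OF U] unitary_cancel[OF V])
  also have "D e * (D z * D e) = D e"
    by (simp add: D_def mult.assoc[symmetric] eze)
  finally have 3: "E * Z * E = E" by (simp add: E_def)
  show thesis by (rule that[OF E carr AE N0 1 2 3])
qed

text \<open>The difference \<open>G\<close> of the two infinitesimal remainders satisfies \<open>G = X S + S Y\<close> for the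
  common standard part \<open>S\<close>, because both essential parts are regular, whereas
  \<open>G\<^sup>* S = 0\<close> and \<open>S G\<^sup>* = 0\<close>. Hence \<open>(G G\<^sup>*)\<^sup>2 = 0\<close>.\<close>

lemma essential_part_unique:
  assumes A: "A \<in> carrier_mat n n" and 1: "is_svd A r t \<mu> U V" and 2: "is_svd A r' t' \<mu>' U' V'"
  shows "U * appreciable_svd_mat n r \<mu> * adj V = U' * appreciable_svd_mat n r' \<mu>' * adj V'"
proof -
  \<comment> \<open>This is the infinitesimal part of \<open>E * Z * E = E\<close>, its terms
    grouped by whether the standard part of \<open>E\<close> stands on the right or on the
    left.\<close>
  have decompose: "inf_mat E = (inf_mat E * std_mat Z + std_mat E * inf_mat Z) * std_mat E
      + std_mat E * (std_mat Z * inf_mat E)"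
    if c: "E \<in> carrier_mat n n" "Z \<in> carrier_mat n n" and EZE: "E * Z * E = E"
    for E Z :: "complex_dual mat"
  proof -
    let ?s = "std_mat E" and ?i = "inf_mat E"
    have cc: "?i * std_mat Z \<in> carrier_mat n n" "?s * inf_mat Z \<in> carrier_mat n n"
      "?s * std_mat Z * ?i \<in> carrier_mat n n"
      "(?i * std_mat Z + ?s * inf_mat Z) * ?s \<in> carrier_mat n n" using c by auto
    have "inf_mat (E * Z * E) = std_mat (E * Z) * ?i + inf_mat (E * Z) * ?s"
      using c by (intro inf_mat_mult) auto
    moreover have "std_mat (E * Z) = ?s * std_mat Z" using c by (intro std_mat_mult) auto
    moreover have "inf_mat (E * Z) = ?s * inf_mat Z + ?i * std_mat Z" using c by (intro inf_mat_mult) auto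
    moreover have "?s * inf_mat Z + ?i * std_mat Z = ?i * std_mat Z + ?s * inf_mat Z"
      using cc by (intro comm_add_mat)
    ultimately have "?i = ?s * std_mat Z * ?i + (?i * std_mat Z + ?s * inf_mat Z) * ?s"
      unfolding EZE by simp
    also have "\<dots> = (?i * std_mat Z + ?s * inf_mat Z) * ?s + ?s * std_mat Z * ?i"
      using cc by (intro comm_add_mat)
    also have "?s * std_mat Z * ?i = ?s * (std_mat Z * ?i)"
      using c by (intro assoc_mult_mat_dim) auto
    finally show ?thesis .
  qed
  obtain E N Z where E: "E = U * appreciable_svd_mat n r \<mu> * adj V"
    and c: "E \<in> carrier_mat n n" "N \<in> carrier_mat n n" "Z \<in> carrier_mat n n"
    and AE: "A = E + N" and N0: "std_mat N = 0\<^sub>m n n"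
    and orth: "adj N * E = 0\<^sub>m n n" "E * adj N = 0\<^sub>m n n" and reg: "E * Z * E = E"
    using svd_split[OF A 1] by blast
  obtain E' N' Z' where E': "E' = U' * appreciable_svd_mat n r' \<mu>' * adj V'"
    and c': "E' \<in> carrier_mat n n" "N' \<in> carrier_mat n n" "Z' \<in> carrier_mat n n"
    and AE': "A = E' + N'" and N0': "std_mat N' = 0\<^sub>m n n"
    and orth': "adj N' * E' = 0\<^sub>m n n" "E' * adj N' = 0\<^sub>m n n" and reg': "E' * Z' * E' = E'"
    using svd_split[OF A 2] by blast
  define S where "S = std_mat A"
  have "std_mat E = std_mat (E + N)"
    if "E \<in> carrier_mat n n" "N \<in> carrier_mat n n" "std_mat N = 0\<^sub>m n n" for E N :: "complex_dual mat"
    using that by (auto simp: mat_eq_iff)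
  from this[OF c(1,2) N0] this[OF c'(1,2) N0'] have S: "std_mat E = S" "std_mat E' = S"
    by (simp_all add: S_def AE[symmetric] AE'[symmetric])
  have Sc: "S \<in> carrier_mat n n" using A by (simp add: S_def)
  define F where "F = inf_mat N"
  define F' where "F' = inf_mat N'"
  have Fc: "F \<in> carrier_mat n n" "F' \<in> carrier_mat n n" using c c' by (auto simp: F_def F'_def)
  \<comment> \<open>In the infinitesimal parts of the orthogonality relations the term with the
    standard part of \<open>N\<close> drops out, which leaves only \<open>adj F\<close> times
    \<open>S\<close>.\<close>
  have FS: "adj F * S = 0\<^sub>m n n" "S * adj F = 0\<^sub>m n n"
    if c: "E \<in> carrier_mat n n" "N \<in> carrier_mat n n" and n0: "std_mat N = 0\<^sub>m n n" and S: "std_mat E = S"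
      and orth: "adj N * E = 0\<^sub>m n n" "E * adj N = 0\<^sub>m n n" and F: "F = inf_mat N"
    for E N :: "complex_dual mat" and F
  proof -
    have aF: "inf_mat (adj N) = adj F" using c by (intro eq_matI) (auto simp: F)
    have 0: "std_mat (adj N) = 0\<^sub>m n n"
      using c arg_cong[OF n0, of adj] by (simp add: mat_eq_iff)
    have z: "inf_mat (0\<^sub>m n n) = (0\<^sub>m n n :: complex mat)" by (intro eq_matI) auto
    have d: "adj F \<in> carrier_mat n n" "inf_mat E \<in> carrier_mat n n" "S \<in> carrier_mat n n"
      using c F S by auto
    show "adj F * S = 0\<^sub>m n n"
      using arg_cong[OF orth(1), of inf_mat] c d by (simp add: inf_mat_mult aF 0 S z)
    show "S * adj F = 0\<^sub>m n n"
      using arg_cong[OF orth(2), of inf_mat] c d by (simp add: inf_mat_mult aF 0 S z)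
  qed
  note FS1 = FS[OF c(1,2) N0 S(1) orth F_def] and FS2 = FS[OF c'(1,2) N0' S(2) orth' F'_def]
  define G where "G = F - F'"
  have G: "G \<in> carrier_mat n n" using Fc by (auto simp: G_def)
  have adjG: "adj G = adj F - adj F'"
    using Fc by (intro eq_matI) (auto simp: G_def)
  have GS: "adj G * S = 0\<^sub>m n n" "S * adj G = 0\<^sub>m n n"
    unfolding adjG using Fc Sc FS1 FS2
    by (simp_all add: minus_mult_distrib_mat[of _ n n _ _ n] mult_minus_distrib_mat[of _ n n _ n])
  define X where "X E Z = inf_mat E * std_mat Z + S * inf_mat Z" for E Z :: "complex_dual mat"
  define Y where "Y E Z = std_mat Z * inf_mat E" for E Z :: "complex_dual mat"
  have dec: "inf_mat E = X E Z * S + S * Y E Z" "inf_mat E' = X E' Z' * S + S * Y E' Z'"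
    using decompose[OF c(1,3) reg] decompose[OF c'(1,3) reg'] by (simp_all add: X_def Y_def S)
  have XY: "X E Z \<in> carrier_mat n n" "Y E Z \<in> carrier_mat n n" "X E' Z' \<in> carrier_mat n n" "Y E' Z' \<in> carrier_mat n n"
    using c c' Sc by (auto simp: X_def Y_def)
  \<comment> \<open>The right factor \<open>adj G\<close> annihilates the term ending in
    \<open>S\<close>, the left one the term beginning with \<open>S\<close>.\<close>
  have kill: "adj G * ((X * S + S * Y) * adj G) = 0\<^sub>m n n"
    if "X \<in> carrier_mat n n" "Y \<in> carrier_mat n n" for X Y
  proof -
    have "(X * S + S * Y) * adj G = X * S * adj G + S * Y * adj G"
      using that Sc G by (intro add_mult_distrib_mat[of _ n n _ _ n]) auto
    also have "\<dots> = X * (S * adj G) + S * (Y * adj G)"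
      using that Sc G by (simp add: assoc_mult_mat_dim)
    also have "\<dots> = S * (Y * adj G)" using that Sc G GS by simp
    also have "adj G * \<dots> = (adj G * S) * (Y * adj G)"
      using that Sc G by (simp add: assoc_mult_mat_dim)
    also have "\<dots> = 0\<^sub>m n n" using that G GS by simp
    finally show ?thesis .
  qed
  have "inf_mat E + F = inf_mat E' + F'"
    using c c' arg_cong[OF AE[symmetric, unfolded AE'], of inf_mat]
    by (auto simp: mat_eq_iff F_def F'_def)
  then have GE: "G = inf_mat E' - inf_mat E"
    using c c' by (auto simp: mat_eq_iff G_def F_def F'_def algebra_simps)
  have ic: "inf_mat E \<in> carrier_mat n n" "inf_mat E' \<in> carrier_mat n n" using c c' by auto
  have "adj G * (G * adj G) = adj G * ((inf_mat E' - inf_mat E) * adj G)"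
    by (simp only: GE[symmetric])
  also have "(inf_mat E' - inf_mat E) * adj G = inf_mat E' * adj G - inf_mat E * adj G"
    using G ic by (intro minus_mult_distrib_mat[of _ n n _ _ n]) auto
  also have "adj G * \<dots> = adj G * (inf_mat E' * adj G) - adj G * (inf_mat E * adj G)"
    using G ic by (intro mult_minus_distrib_mat[of _ n n _ n]) auto
  also have "\<dots> = 0\<^sub>m n n"
    unfolding dec using kill XY by simp
  finally have "adj G * (G * adj G) = 0\<^sub>m n n" .
  \<comment> \<open>\<open>G * adj G\<close> is its own adjoint, so
    \<open>adj_mult_self_eq_0\<close> applies first to it and then to \<open>adj G\<close>.\<close>
  then have "adj (G * adj G) * (G * adj G) = 0\<^sub>m n n"
    using G by (simp add: adj_mult assoc_mult_mat_dim)
  then have "G * adj G = 0\<^sub>m n n" using adj_mult_self_eq_0[of "G * adj G"] G by simp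
  then have "adj G = 0\<^sub>m n n" using adj_mult_self_eq_0[of "adj G"] G by simp
  then have "G = 0\<^sub>m n n" using adj_adj[of G] by simp
  then have "inf_mat E = inf_mat E'"
    using ic unfolding GE by (auto simp: mat_eq_iff)
  then have "E = E'" using S by (metis dual_mat_parts)
  then show ?thesis using E E' by simp
qed

text \<open>Resolves the definite description, so that any one decomposition computes the essential
  part.\<close>

lemma essential_part_eq:
  assumes A: "A \<in> carrier_mat n n" and svd: "is_svd A r t \<mu> U V"
  shows "essential_part A = U * appreciable_svd_mat n r \<mu> * adj V"
proof -
  have "essential_part A = (THE E. \<exists>r t \<mu> U V. is_svd A r t \<mu> U V \<and>
      E = U * appreciable_svd_mat n r \<mu> * adj V)"
    unfolding essential_part_def appreciable_svd_mat_def ctranspose_eq_adj carrier_matD[OF A] ..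
  also have "\<dots> = U * appreciable_svd_mat n r \<mu> * adj V"
  proof (rule the_equality)
    fix E assume "\<exists>r t \<mu> U V. is_svd A r t \<mu> U V \<and> E = U * appreciable_svd_mat n r \<mu> * adj V"
    then obtain r' t' \<mu>' U' V' where "is_svd A r' t' \<mu>' U' V'"
      and E: "E = U' * appreciable_svd_mat n r' \<mu>' * adj V'" by blast
    then show "E = U * appreciable_svd_mat n r \<mu> * adj V"
      unfolding E by (intro essential_part_unique[OF A _ svd])
  qed (use svd in blast)
  finally show ?thesis .
qed

theorem theorem3p2:
  fixes n :: nat and A :: "complex_dual mat"
  assumes "A \<in> carrier_mat n n"
  shows "\<exists>r t \<mu> U \<Sigma>1 \<Sigma>2 K L M N.
    r \<le> t \<and> t \<le> n \<and> singular_values r t \<mu> \<and> unitary_mat n U \<and>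
    \<Sigma>1 = Sigma1_mat r \<mu> \<and> \<Sigma>2 = Sigma2_mat n n r t \<mu> \<and>
    K \<in> carrier_mat r r \<and> L \<in> carrier_mat r (n - r) \<and>
    M \<in> carrier_mat (n - r) r \<and> N \<in> carrier_mat (n - r) (n - r) \<and>
    K * ctranspose K + L * ctranspose L = 1\<^sub>m r \<and>
    K * ctranspose M + L * ctranspose N = 0\<^sub>m r (n - r) \<and>
    A = U * four_block_mat
              (complex_mat_of_dual \<Sigma>1 * K) (complex_mat_of_dual \<Sigma>1 * L)
              (complex_mat_of_dual \<Sigma>2 * M) (complex_mat_of_dual \<Sigma>2 * N)
          * ctranspose U \<and>
    essential_part A =
        U * four_block_mat
              (complex_mat_of_dual \<Sigma>1 * K) (complex_mat_of_dual \<Sigma>1 * L)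
              (0\<^sub>m (n - r) r) (0\<^sub>m (n - r) (n - r))
          * ctranspose U"
proof -
  obtain r t \<mu> U V where svd: "is_svd A r t \<mu> U V" using svd_exists[OF assms] .
  note svd' = svd[unfolded is_svd_iff[OF assms]]
  have U: "is_unitary n U" and V: "is_unitary n V" and rn: "r \<le> n" using svd' by auto
  define W where "W = adj V * U"
  have W: "is_unitary n W" unfolding W_def by (intro is_unitary_mult is_unitary_adj U V)
  obtain K L M N where split: "split_block W r r = (K, L, M, N)" by (cases "split_block W r r") auto
  have dimW: "dim_row W = r + (n - r)" "dim_col W = r + (n - r)" using is_unitaryD[OF W] rn by auto
  note c = split_block(1-4)[OF split dimW] and W_eq = split_block(5)[OF split dimW]
  let ?S1 = "complex_mat_of_dual (Sigma1_mat r \<mu>)"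
  let ?S2 = "complex_mat_of_dual (Sigma2_mat n n r t \<mu>)"
  have "four_block_mat (K * adj K + L * adj L) (K * adj M + L * adj N)
      (M * adj K + N * adj L) (M * adj M + N * adj N) = W * adj W"
    unfolding W_eq using c
    by (simp add: adj_four_block[of _ r r _ "n - r" _ "n - r"]
        mult_four_block_mat[of _ r r _ "n - r" _ "n - r" _ _ r _ "n - r"])
  also have "\<dots> = four_block_mat (1\<^sub>m r) (0\<^sub>m r (n - r)) (0\<^sub>m (n - r) r) (1\<^sub>m (n - r))"
    using is_unitaryD(3)[OF W] rn by simp
  finally have blocks: "four_block_mat (K * adj K + L * adj L) (K * adj M + L * adj N)
      (M * adj K + N * adj L) (M * adj M + N * adj N)
    = four_block_mat (1\<^sub>m r) (0\<^sub>m r (n - r)) (0\<^sub>m (n - r) r) (1\<^sub>m (n - r))" .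
  have KL: "K * adj K + L * adj L = 1\<^sub>m r"
  proof (intro eq_matI)
    fix i j assume "i < dim_row (1\<^sub>m r :: complex_dual mat)" "j < dim_col (1\<^sub>m r :: complex_dual mat)"
    then show "(K * adj K + L * adj L) $$ (i, j) = 1\<^sub>m r $$ (i, j)"
      using c arg_cong[OF blocks, of "\<lambda>X. X $$ (i, j)"] by (simp del: index_mult_mat(1) index_add_mat(1))
  qed (use c in auto)
  have MN: "K * adj M + L * adj N = 0\<^sub>m r (n - r)"
  proof (intro eq_matI)
    fix i j assume "i < dim_row (0\<^sub>m r (n - r) :: complex_dual mat)"
      "j < dim_col (0\<^sub>m r (n - r) :: complex_dual mat)"
    \<comment> \<open>The column offset \<open>r\<close> selects the upper right block.\<close>
    then show "(K * adj M + L * adj N) $$ (i, j) = 0\<^sub>m r (n - r) $$ (i, j)"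
      using c arg_cong[OF blocks, of "\<lambda>X. X $$ (i, j + r)"]
      by (simp del: index_mult_mat(1) index_add_mat(1))
  qed (use c in auto)
  \<comment> \<open>This holds for every middle factor, so one \<open>W\<close> serves both the full
    and the truncated product.\<close>
  have move: "U * B * adj V = U * (B * W) * adj U" if "B \<in> carrier_mat n n" for B
    unfolding W_def using that is_unitaryD[OF U] is_unitaryD[OF V] by (simp add: assoc_mult_mat_dim)
  have s: "?S1 \<in> carrier_mat r r" "?S2 \<in> carrier_mat (n - r) (n - r)" by simp_all
  have p: "?S1 * K \<in> carrier_mat r r" "?S1 * L \<in> carrier_mat r (n - r)"
    "?S2 * M \<in> carrier_mat (n - r) r" "?S2 * N \<in> carrier_mat (n - r) (n - r)"
    by (rule mult_carrier_mat[OF s(1) c(1)] mult_carrier_mat[OF s(1) c(2)]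
        mult_carrier_mat[OF s(2) c(3)] mult_carrier_mat[OF s(2) c(4)])+
  have "svd_mat n r t \<mu> * W = four_block_mat (?S1 * K) (?S1 * L) (?S2 * M) (?S2 * N)"
    unfolding W_eq svd_mat_def using c p
    by (simp add: mult_four_block_mat[of _ r r _ "n - r" _ "n - r" _ _ r _ "n - r"])
  moreover have "svd_mat n r t \<mu> \<in> carrier_mat n n" "appreciable_svd_mat n r \<mu> \<in> carrier_mat n n"
    by (simp_all add: svd_mat_eq_mat_diag[OF rn])
  moreover have "appreciable_svd_mat n r \<mu> * W
      = four_block_mat (?S1 * K) (?S1 * L) (0\<^sub>m (n - r) r) (0\<^sub>m (n - r) (n - r))"
    unfolding W_eq appreciable_svd_mat_def using c p
    by (simp add: mult_four_block_mat[of _ r r _ "n - r" _ "n - r" _ _ r _ "n - r"])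
  ultimately have "A = U * four_block_mat (?S1 * K) (?S1 * L) (?S2 * M) (?S2 * N) * adj U"
    "essential_part A = U * four_block_mat (?S1 * K) (?S1 * L) (0\<^sub>m (n - r) r) (0\<^sub>m (n - r) (n - r)) * adj U"
    using svd' essential_part_eq[OF assms svd] move by metis+
  with svd' c KL MN show ?thesis
    unfolding ctranspose_eq_adj unitary_mat_eq_is_unitary by blast
qed

end
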